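(* Let $a,b\in\mathbb{Q}$ with $a\neq0$, let $f(x)=x^8+ax^6+bx^4+ax^2+1\in\mathbb{Q}[x]$ be irreducible over $\mathbb{Q}$, and suppose that $(b+2)^2-4a^2\in\mathbb{Q}^2$. Then the following algorithm (each step being applied only if the conditions of all previous steps fail) returns $\mathrm{Gal}(f)$. (1) If $b+2+2a\in\mathbb{Q}^2$, return 8T3. (2) Else if $$\frac{b-6+\sqrt{(b+2)^2-4a^2}}{2}\in\mathbb{Q}^2\quad\text{or}\quad\frac{b-6-\sqrt{(b+2)^2-4a^2}}{2}\in\mathbb{Q}^2,$$ return 8T4. (3) Else if $(a^2-4b+8)(b+2+2a)\in\mathbb{Q}^2$, return 8T2. (4) Otherwise, return 8T9.
   Context: $\mathbb{Q}^2=\{k^2:k\in\mathbb{Q}\}$. $\mathrm{Gal}(f)$ is the Galois group over $\mathbb{Q}$ of (the splitting field of) $f$, viewed as a transitive permutation group on the eight roots of $f$, i.e. as a transitive subgroup of $S_8$ up to conjugacy. 8Tj denotes the $j$-th conjugacy class of transitive subgroups of $S_8$ in the Butler–McKay (LMFDB) numbering. The classes used here are identified as follows; each consists of exactly the transitive subgroups of $S_8$ that are isomorphic, as abstract groups, to the indicated group: 8T2: $C_4\times C_2$ (order 8); 8T3: $C_2^3$ (order 8); 8T4: the dihedral group $D_4$ of order 8; 8T9: $C_2\times D_4$ (order 16). *)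

theory Defs
  imports
    Complex_Main
    "HOL-Algebra.Algebraic_Closure_Type"
    "HOL-Algebra.Generated_Fields"
    "HOL-Algebra.Sym_Groups"
    "HOL-Algebra.Elementary_Groups"
    "HOL-Algebra.Bij"
begin

definition rat_squares :: "real set"
  where "rat_squares = {(of_rat k)\<^sup>2 | k :: rat. True}"

section \<open>The Galois group of a rational polynomial\<close>

definition complex_roots :: "rat poly \<Rightarrow> complex set"
  where "complex_roots f = {z. poly (map_poly of_rat f) z = 0}"

text \<open>The subfield of the complex numbers generated by the roots; as a subfield
  of characteristic 0 it contains the rational numbers.\<close>

definition splitting_field :: "rat poly \<Rightarrow> complex ring"
  where "splitting_field f =
    ring_of_type_algebra
      \<lparr>carrier := generate_field ring_of_type_algebra (complex_roots f)\<rparr>"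

definition galois_group :: "rat poly \<Rightarrow> (complex \<Rightarrow> complex) monoid"
  where "galois_group f =
    BijGroup (carrier (splitting_field f))
      \<lparr>carrier := {\<sigma> \<in> Bij (carrier (splitting_field f)).
          \<sigma> \<in> ring_hom (splitting_field f) (splitting_field f) \<and>
          (\<forall>q. \<sigma> (of_rat q) = of_rat q)}\<rparr>"

text \<open>The permutations of \<open>{1..n}\<close> induced by the Galois group via the numbering
  \<open>e 1, \<dots>, e n\<close> of the roots. Changing the numbering conjugates the group in
  \<open>sym_group n\<close>.\<close>

definition galois_perms :: "rat poly \<Rightarrow> nat \<Rightarrow> (nat \<Rightarrow> complex) \<Rightarrow> (nat \<Rightarrow> nat) set"
  where "galois_perms f n e =
    {p. p permutes {1..n} \<and>
        (\<exists>\<sigma> \<in> carrier (galois_group f). \<forall>i \<in> {1..n}. \<sigma> (e i) = e (p i))}"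

text \<open>Up to conjugacy, the Galois group as a permutation group on the \<open>n\<close> (distinct) roots
  belongs to the conjugation-invariant family \<open>C\<close> of subgroups of \<open>sym_group n\<close>.\<close>

definition galois_group_in_class :: "rat poly \<Rightarrow> nat \<Rightarrow> (nat \<Rightarrow> nat) set set \<Rightarrow> bool"
  where "galois_group_in_class f n C \<longleftrightarrow>
    (\<exists>e. bij_betw e {1..n} (complex_roots f) \<and> galois_perms f n e \<in> C)"

section \<open>Classes of transitive groups of degree 8\<close>

text \<open>The dihedral group of order \<open>2 * n\<close>: \<open>(i, s)\<close> is the rotation by \<open>i\<close> steps,
  preceded by a fixed reflection if \<open>s\<close> holds.\<close>

definition dihedral_group :: "nat \<Rightarrow> (int \<times> bool) monoid"
  where "dihedral_group n =
    \<lparr>carrier = {0..<int n} \<times> UNIV,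
     monoid.mult = (\<lambda>(i, s) (j, t). ((if s then i - j else i + j) mod int n, s \<noteq> t)),
     one = (0, False)\<rparr>"

definition transitive_subgroups :: "nat \<Rightarrow> (nat \<Rightarrow> nat) set set"
  where "transitive_subgroups n =
    {H. subgroup H (sym_group n) \<and> (\<forall>i \<in> {1..n}. \<forall>j \<in> {1..n}. \<exists>p \<in> H. p i = j)}"

definition transitive_subgroups_iso :: "nat \<Rightarrow> 'a monoid \<Rightarrow> (nat \<Rightarrow> nat) set set"
  where "transitive_subgroups_iso n G =
    {H \<in> transitive_subgroups n. (sym_group n)\<lparr>carrier := H\<rparr> \<cong> G}"

text \<open>For the following four isomorphism types, the transitive subgroups of \<open>sym_group 8\<close>
  of that type form a single conjugacy class; the names are those of the Butler--McKay
  (LMFDB) numbering.\<close>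

definition T8_2 :: "(nat \<Rightarrow> nat) set set"
  where "T8_2 = transitive_subgroups_iso 8 (integer_mod_group 4 \<times>\<times> integer_mod_group 2)"

definition T8_3 :: "(nat \<Rightarrow> nat) set set"
  where "T8_3 = transitive_subgroups_iso 8
    (integer_mod_group 2 \<times>\<times> integer_mod_group 2 \<times>\<times> integer_mod_group 2)"

definition T8_4 :: "(nat \<Rightarrow> nat) set set"
  where "T8_4 = transitive_subgroups_iso 8 (dihedral_group 4)"

definition T8_9 :: "(nat \<Rightarrow> nat) set set"
  where "T8_9 = transitive_subgroups_iso 8 (integer_mod_group 2 \<times>\<times> dihedral_group 4)"

end

theory Submission
  imports Defs "HOL-Computational_Algebra.Field_as_Ring"
begin

text \<open>
  Write \<open>z\<close> for a root of \<open>f\<close> and \<open>t = z\<^sup>2 + 1 / z\<^sup>2\<close>. As \<open>f\<close> is reciprocal and even,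
  \<open>f z = z\<^sup>4 * (t\<^sup>2 + a * t + b - 2)\<close>. Let \<open>u 0\<close>, \<open>u 1\<close> be the roots of this quadratic and \<open>\<delta>\<close>
  their difference, so that \<open>\<delta>\<^sup>2 = a\<^sup>2 - 4 * b + 8\<close>. From \<open>(z + 1/z)\<^sup>2 = t + 2\<close> and
  \<open>(z - 1/z)\<^sup>2 = t - 2\<close>, the eight roots are \<open>(\<plusminus> P j \<plusminus> M j) / 2\<close>, where \<open>(P j)\<^sup>2 = u j + 2\<close> and
  \<open>(M j)\<^sup>2 = u j - 2\<close>. The product \<open>P 0 * P 1 * M 0 * M 1\<close> squares to \<open>(b + 2)\<^sup>2 - 4 * a\<^sup>2\<close>, and
  the assumption on this number says exactly that the product is a rational number \<open>s\<close>.

  Put \<open>w = M 0 * M 1\<close>; then \<open>w\<^sup>2 = b + 2 + 2 * a\<close>. An automorphism \<open>\<sigma>\<close> of the splitting field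
  permutes \<open>u 0\<close>, \<open>u 1\<close> and sends \<open>w\<close> to \<open>\<plusminus> w\<close>. It is determined by four bits \<open>j\<close>, \<open>e\<close>, \<open>d\<close>, \<open>h\<close> with
  \<open>\<sigma> (P 0) = (-1)\<^sup>e * P j\<close>, \<open>\<sigma> (M 0) = (-1)\<^sup>d * M j\<close> and \<open>\<sigma> w = (-1)\<^sup>h * w\<close>, because
  \<open>P 1 = s / (w * P 0)\<close> and \<open>M 1 = w / M 0\<close>. Under composition of \<open>\<sigma>\<close> with \<open>\<sigma>'\<close> (the latter
  applied first), \<open>j\<close> and \<open>h\<close> add modulo 2, while \<open>e\<close> and \<open>d\<close> add up to the common correction
  \<open>j' * h\<close>. All 16 quadruples with this law form a group isomorphic to \<open>C\<^sub>2 \<times> D\<^sub>4\<close>, so the Galois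
  group is a subgroup of it. By irreducibility it acts transitively on the roots, hence the
  bits \<open>j\<close>, \<open>e\<close>, \<open>d\<close> take all eight values.

  If \<open>w\<close> is not in the field \<open>\<rat>(z)\<close>, the sign of \<open>w\<close> can be chosen independently and all 16
  quadruples occur. If \<open>w\<close> is in \<open>\<rat>(z)\<close>, then \<open>h\<close> is a function of \<open>j\<close>, \<open>e\<close>, \<open>d\<close>, and the
  composition law forces this function to be \<open>0\<close>, \<open>j\<close>, \<open>e + d\<close> or \<open>e + d + j\<close>
  (lemma \<open>twisted_additive_bool\<close>). These four cases say that every automorphism fixes \<open>w\<close>,
  \<open>\<delta> * w\<close>, \<open>P 0 * M 1 + P 1 * M 0\<close> or \<open>P 0 * M 1 - P 1 * M 0\<close> respectively, that is, that this
  number is rational. The squares of these numbers are, up to a rational square factor, those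
  that the algorithm inspects. In the group of quadruples, \<open>h = 0\<close> leaves \<open>C\<^sub>2\<^sup>3\<close>, \<open>h = j\<close> leaves
  \<open>C\<^sub>4 \<times> C\<^sub>2\<close>, and the other two conditions leave \<open>D\<^sub>4\<close>.

  Two tools from Galois theory are needed. Automorphisms are constructed from their graphs, as
  subrings of \<open>\<complex> \<times> \<complex>\<close> (lemma \<open>galois_from_graph\<close>). An element of \<open>\<rat>(z)\<close> that all automorphisms
  fix is rational, since it is the common value of one polynomial of degree less than 8 at all
  eight roots (lemma \<open>fixed_imp_rational\<close>).
\<close>

section \<open>Subfields of the complex numbers\<close>

lemma complex_field: "field (ring_of_type_algebra :: complex ring)"
  by (rule field_from_type_algebra)

lemma complex_field_uminus: "\<ominus>\<^bsub>ring_of_type_algebra\<^esub> x = - x" for x :: complex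
proof -
  interpret C: field "ring_of_type_algebra :: complex ring" by (rule complex_field)
  show ?thesis by (rule C.minus_equality) (auto simp: ring_of_type_algebra_def)
qed

lemma complex_field_inverse:
  fixes x :: complex
  assumes "x \<noteq> 0"
  shows "inv\<^bsub>ring_of_type_algebra\<^esub> x = inverse x"
proof -
  interpret C: field "ring_of_type_algebra :: complex ring" by (rule complex_field)
  show ?thesis
    by (rule C.comm_inv_char) (use assms in \<open>auto simp: ring_of_type_algebra_def\<close>)
qed

lemma subfield_complexI:
  fixes S :: "complex set"
  assumes "1 \<in> S" "\<And>x y. x \<in> S \<Longrightarrow> y \<in> S \<Longrightarrow> x + y \<in> S"
    "\<And>x y. x \<in> S \<Longrightarrow> y \<in> S \<Longrightarrow> x * y \<in> S" "\<And>x. x \<in> S \<Longrightarrow> - x \<in> S"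
    "\<And>x. x \<in> S \<Longrightarrow> x \<noteq> 0 \<Longrightarrow> inverse x \<in> S"
  shows "subfield S ring_of_type_algebra"
proof -
  interpret C: field "ring_of_type_algebra :: complex ring" by (rule complex_field)
  have R: "carrier ring_of_type_algebra = (UNIV :: complex set)"
    "\<zero>\<^bsub>ring_of_type_algebra\<^esub> = (0 :: complex)" "\<one>\<^bsub>ring_of_type_algebra\<^esub> = (1 :: complex)"
    "monoid.mult ring_of_type_algebra = ((*) :: complex \<Rightarrow> _)" "add ring_of_type_algebra = ((+) :: complex \<Rightarrow> _)"
    by (auto simp: ring_of_type_algebra_def)
  have "subring S ring_of_type_algebra"
    by (rule C.subringI) (use assms in \<open>auto simp: complex_field_uminus R\<close>)
  then show ?thesis
    by (rule C.subfieldI') (use assms in \<open>auto simp: R complex_field_inverse\<close>)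
qed

lemma
  fixes S :: "complex set"
  assumes "subfield S ring_of_type_algebra"
  shows subfield_complex_1: "1 \<in> S"
    and subfield_complex_add: "\<And>x y. x \<in> S \<Longrightarrow> y \<in> S \<Longrightarrow> x + y \<in> S"
    and subfield_complex_mult: "\<And>x y. x \<in> S \<Longrightarrow> y \<in> S \<Longrightarrow> x * y \<in> S"
    and subfield_complex_uminus: "\<And>x. x \<in> S \<Longrightarrow> - x \<in> S"
    and subfield_complex_inverse: "\<And>x. x \<in> S \<Longrightarrow> inverse x \<in> S"
proof -
  interpret C: field "ring_of_type_algebra :: complex ring" by (rule complex_field)
  have R: "carrier ring_of_type_algebra = (UNIV :: complex set)"
    "\<zero>\<^bsub>ring_of_type_algebra\<^esub> = (0 :: complex)" "\<one>\<^bsub>ring_of_type_algebra\<^esub> = (1 :: complex)"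
    "monoid.mult ring_of_type_algebra = ((*) :: complex \<Rightarrow> _)" "add ring_of_type_algebra = ((+) :: complex \<Rightarrow> _)"
    by (auto simp: ring_of_type_algebra_def)
  note sr = subringE[OF subfieldE(1)[OF assms], unfolded R complex_field_uminus]
  show "1 \<in> S" by (rule sr(3))
  show "\<And>x y. x \<in> S \<Longrightarrow> y \<in> S \<Longrightarrow> x + y \<in> S" by (rule sr(7))
  show "\<And>x y. x \<in> S \<Longrightarrow> y \<in> S \<Longrightarrow> x * y \<in> S" by (rule sr(6))
  show "\<And>x. x \<in> S \<Longrightarrow> - x \<in> S" by (rule sr(5))
  show "inverse x \<in> S" if "x \<in> S" for x
    using C.subfield_m_inv(1)[OF assms, of x] complex_field_inverse[of x] sr(2) that R
    by (cases "x = 0") auto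
qed

lemma subfield_complex_rat:
  assumes S: "subfield (S :: complex set) ring_of_type_algebra"
  shows "of_rat q \<in> S"
proof -
  have n: "of_nat n \<in> S" for n
  proof (induction n)
    case 0
    have "1 + - 1 \<in> S"
      by (intro subfield_complex_add[OF S] subfield_complex_uminus[OF S] subfield_complex_1[OF S])
    then show ?case by simp
  next
    case (Suc n)
    then show ?case
      using subfield_complex_add[OF S] subfield_complex_1[OF S] by simp
  qed
  have i: "of_int m \<in> S" for m
    using n subfield_complex_uminus[OF S] by (cases m rule: int_cases2) auto
  obtain m k where "q = Rat.Fract m k" "k > 0"
    by (cases q) auto
  then have "of_rat q = of_int m * inverse (of_int k :: complex)"
    by (simp add: of_rat_rat divide_inverse)
  then show ?thesis
    using i subfield_complex_mult[OF S] subfield_complex_inverse[OF S] by simp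
qed

text \<open>The arguments below only use the underlying set of the splitting field, with the operations of
  the complex numbers: it is the smallest subfield that contains the roots.\<close>

abbreviation splitting_set :: "rat poly \<Rightarrow> complex set"
  where "splitting_set f \<equiv> carrier (splitting_field f)"

lemma splitting_set_subfield: "subfield (splitting_set f) ring_of_type_algebra"
  using field.generate_field_is_subfield[OF complex_field, of "complex_roots f"]
  by (simp add: splitting_field_def ring_of_type_algebra_def)

lemma roots_subset_splitting_set: "complex_roots f \<subseteq> splitting_set f"
  by (auto simp: splitting_field_def intro: generate_field.incl)

lemma splitting_set_minimal:
  assumes "subfield S ring_of_type_algebra" "complex_roots f \<subseteq> S"
  shows "splitting_set f \<subseteq> S"
  using field.generate_field_min_subfield1[OF complex_field _ assms]
  by (simp add: splitting_field_def ring_of_type_algebra_def)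

lemmas splitting_set_closed [simp, intro] =
  subfield_complex_1[OF splitting_set_subfield]
  subfield_complex_add[OF splitting_set_subfield]
  subfield_complex_mult[OF splitting_set_subfield]
  subfield_complex_uminus[OF splitting_set_subfield]
  subfield_complex_inverse[OF splitting_set_subfield]
  subfield_complex_rat[OF splitting_set_subfield]

section \<open>Evaluation of rational polynomials\<close>

abbreviation qeval :: "rat poly \<Rightarrow> complex \<Rightarrow> complex"
  where "qeval g z \<equiv> poly (map_poly of_rat g) z"

lemma qeval_pCons [simp]: "qeval (pCons c g) z = of_rat c + z * qeval g z"
  by (simp add: map_poly_pCons)

lemma qeval_add [simp]: "qeval (g + h) z = qeval g z + qeval h z"
proof -
  have "map_poly of_rat (g + h) = (map_poly of_rat g + map_poly of_rat h :: complex poly)"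
    by (rule poly_eqI) (simp add: coeff_map_poly of_rat_add)
  then show ?thesis by simp
qed

lemma qeval_smult [simp]: "qeval (smult c g) z = of_rat c * qeval g z"
  by (simp add: map_poly_smult of_rat_mult)

lemma qeval_mult [simp]: "qeval (g * h) z = qeval g z * qeval h z"
  by (induction g) (simp_all add: algebra_simps)

lemma qeval_minus [simp]: "qeval (- g) z = - qeval g z"
  using qeval_smult[of "-1" g z] by simp

lemma qeval_diff [simp]: "qeval (g - h) z = qeval g z - qeval h z"
  using qeval_add[of g "- h" z] by simp

section \<open>The Galois group\<close>

text \<open>This form of the definition replaces the record operations by those of the complex numbers. That
  \<open>\<sigma> 1 = 1\<close> is the case \<open>q = 1\<close> of fixing the rational numbers.\<close>

lemma galois_group_iff:
  "\<sigma> \<in> carrier (galois_group f) \<longleftrightarrow>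
    \<sigma> \<in> Bij (splitting_set f) \<and> (\<forall>q. \<sigma> (of_rat q) = of_rat q) \<and>
    (\<forall>x\<in>splitting_set f. \<forall>y\<in>splitting_set f. \<sigma> (x + y) = \<sigma> x + \<sigma> y \<and> \<sigma> (x * y) = \<sigma> x * \<sigma> y)"
proof -
  have "\<sigma> x \<in> splitting_set f" if "\<sigma> \<in> Bij (splitting_set f)" "x \<in> splitting_set f" for x
    using that Bij_imp_funcset by blast
  moreover have "\<sigma> 1 = 1" if "\<forall>q. \<sigma> (of_rat q) = (of_rat q :: complex)"
    using that[rule_format, of 1] by simp
  ultimately show ?thesis
    by (auto simp: galois_group_def ring_hom_def splitting_field_def ring_of_type_algebra_def)
qed

lemma
  assumes "\<sigma> \<in> carrier (galois_group f)"
  shows galois_closed: "x \<in> splitting_set f \<Longrightarrow> \<sigma> x \<in> splitting_set f"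
    and galois_of_rat: "\<sigma> (of_rat q) = of_rat q"
    and galois_add: "x \<in> splitting_set f \<Longrightarrow> y \<in> splitting_set f \<Longrightarrow> \<sigma> (x + y) = \<sigma> x + \<sigma> y"
    and galois_mult: "x \<in> splitting_set f \<Longrightarrow> y \<in> splitting_set f \<Longrightarrow> \<sigma> (x * y) = \<sigma> x * \<sigma> y"
    and galois_inj: "inj_on \<sigma> (splitting_set f)"
    and galois_extensional: "\<sigma> \<in> extensional (splitting_set f)"
  using assms Bij_imp_funcset[of \<sigma> "splitting_set f"]
  by (auto simp: galois_group_iff Bij_def bij_betw_def)

lemma galois_uminus:
  assumes "\<sigma> \<in> carrier (galois_group f)" "x \<in> splitting_set f"
  shows "\<sigma> (- x) = - \<sigma> x"
  using galois_mult[OF assms(1) _ assms(2), of "of_rat (-1)"] galois_of_rat[OF assms(1), of "-1"]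
  by simp

lemma galois_inverse:
  assumes "\<sigma> \<in> carrier (galois_group f)" "x \<in> splitting_set f"
  shows "\<sigma> (inverse x) = inverse (\<sigma> x)"
proof (cases "x = 0")
  case True
  then show ?thesis using galois_of_rat[OF assms(1), of 0] by simp
next
  case False
  then have "\<sigma> x * \<sigma> (inverse x) = 1"
    using galois_mult[OF assms, of "inverse x"] galois_of_rat[OF assms(1), of 1] assms(2) by simp
  then show ?thesis by (metis inverse_unique)
qed

lemma galois_qeval:
  assumes "\<sigma> \<in> carrier (galois_group f)" "x \<in> splitting_set f"
  shows "qeval g x \<in> splitting_set f \<and> \<sigma> (qeval g x) = qeval g (\<sigma> x)"
proof (induction g)
  case 0
  show ?case
    using galois_of_rat[OF assms(1), of 0] subfield_complex_rat[OF splitting_set_subfield, of 0 f]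
    by simp
next
  case (pCons c g)
  then show ?case
    using assms by (simp add: galois_add galois_mult galois_of_rat splitting_set_closed)
qed

lemma galois_root:
  assumes "\<sigma> \<in> carrier (galois_group f)" "x \<in> complex_roots f"
  shows "\<sigma> x \<in> complex_roots f"
  using galois_qeval[OF assms(1), of x f] assms(2) roots_subset_splitting_set[of f]
    galois_of_rat[OF assms(1), of 0]
  by (auto simp: complex_roots_def)

lemma galois_comp:
  assumes "\<sigma> \<in> carrier (galois_group f)" "\<tau> \<in> carrier (galois_group f)"
  shows "\<sigma> \<otimes>\<^bsub>galois_group f\<^esub> \<tau> = compose (splitting_set f) \<sigma> \<tau>"
  using assms by (simp add: galois_group_iff) (simp add: galois_group_def BijGroup_def)

text \<open>Only closure under inverses needs care: the inverse in \<open>BijGroup\<close> is the restricted inverse map,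
  and it is again additive and multiplicative because every element of the field is an image.\<close>

lemma galois_group_group: "group (galois_group f)"
proof -
  let ?K = "splitting_set f"
  interpret B: group "BijGroup ?K" by (rule group_BijGroup)
  have eq: "galois_group f = (BijGroup ?K)\<lparr>carrier := carrier (galois_group f)\<rparr>"
    by (simp add: galois_group_def)
  have "subgroup (carrier (galois_group f)) (BijGroup ?K)"
  proof (rule B.subgroupI)
    show "carrier (galois_group f) \<subseteq> carrier (BijGroup ?K)"
      by (auto simp: galois_group_iff BijGroup_def)
    have "(\<lambda>x\<in>?K. x) \<in> carrier (galois_group f)"
      by (auto simp: galois_group_iff id_Bij)
    then show "carrier (galois_group f) \<noteq> {}" by blast
  next
    fix \<sigma> assume \<sigma>: "\<sigma> \<in> carrier (galois_group f)"
    then have B: "\<sigma> \<in> Bij ?K" by (simp add: galois_group_iff)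
    let ?i = "restrict (inv_into ?K \<sigma>) ?K"
    have iB: "?i \<in> Bij ?K" by (rule restrict_inv_into_Bij[OF B])
    have "inv\<^bsub>BijGroup ?K\<^esub> \<sigma> = ?i"
      by (rule B.inv_equality)
        (use B iB in \<open>auto simp: BijGroup_def Bij_compose_restrict_eq\<close>)
    moreover have "?i \<in> carrier (galois_group f)"
      unfolding galois_group_iff
    proof (intro conjI ballI allI)
      show "?i \<in> Bij ?K" by fact
      show "?i (of_rat q) = of_rat q" for q
        using galois_inj[OF \<sigma>] galois_of_rat[OF \<sigma>, of q]
        by (simp add: inv_into_f_eq subfield_complex_rat[OF splitting_set_subfield])
      fix x y assume "x \<in> ?K" "y \<in> ?K"
      then obtain x' y' where xy: "x' \<in> ?K" "y' \<in> ?K" "x = \<sigma> x'" "y = \<sigma> y'"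
        using B unfolding Bij_def bij_betw_def by blast
      have inv: "?i (\<sigma> z) = z" if "z \<in> ?K" for z
        using galois_inj[OF \<sigma>] galois_closed[OF \<sigma> that] that by simp
      show "?i (x + y) = ?i x + ?i y"
        using xy inv galois_add[OF \<sigma> xy(1,2)] by (metis splitting_set_closed(2))
      show "?i (x * y) = ?i x * ?i y"
        using xy inv galois_mult[OF \<sigma> xy(1,2)] by (metis splitting_set_closed(3))
    qed
    ultimately show "inv\<^bsub>BijGroup ?K\<^esub> \<sigma> \<in> carrier (galois_group f)" by simp
  next
    fix \<sigma> \<tau> assume st: "\<sigma> \<in> carrier (galois_group f)" "\<tau> \<in> carrier (galois_group f)"
    then have "\<sigma> \<in> Bij ?K" "\<tau> \<in> Bij ?K" by (simp_all add: galois_group_iff)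
    then show "\<sigma> \<otimes>\<^bsub>BijGroup ?K\<^esub> \<tau> \<in> carrier (galois_group f)"
      using st compose_Bij[of \<sigma> ?K \<tau>]
      unfolding galois_group_iff[of "_ \<otimes>\<^bsub>_\<^esub> _"]
      by (auto simp: BijGroup_def compose_def galois_add galois_mult galois_closed galois_of_rat)
  qed
  from subgroup.subgroup_is_group[OF this B.group_axioms] show ?thesis
    using eq by simp
qed

text \<open>The elements on which two automorphisms agree form a subfield; once it contains the roots, it is
  the whole splitting field.\<close>

lemma galois_eqI:
  assumes st: "\<sigma> \<in> carrier (galois_group f)" "\<tau> \<in> carrier (galois_group f)"
    and eq: "\<And>x. x \<in> complex_roots f \<Longrightarrow> \<sigma> x = \<tau> x"
  shows "\<sigma> = \<tau>"
proof -
  let ?S = "{x \<in> splitting_set f. \<sigma> x = \<tau> x}"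
  have "subfield ?S ring_of_type_algebra"
    using galois_of_rat[OF st(1), of 1] galois_of_rat[OF st(2), of 1]
    by (intro subfield_complexI)
      (auto simp: galois_add[OF st(1)] galois_add[OF st(2)] galois_mult[OF st(1)] galois_mult[OF st(2)]
        galois_uminus[OF st(1)] galois_uminus[OF st(2)] galois_inverse[OF st(1)] galois_inverse[OF st(2)])
  then have "splitting_set f \<subseteq> ?S"
    using splitting_set_minimal eq roots_subset_splitting_set by blast
  then show ?thesis
    using galois_extensional[OF st(1)] galois_extensional[OF st(2)] extensionalityI by blast
qed

section \<open>The action on the roots\<close>

text \<open>Transporting each automorphism along the numbering \<open>e\<close> gives a homomorphism \<open>\<Phi>\<close> into the symmetric
  group. It is injective because the roots generate the field, and its image is the permutation
  group of the statement.\<close>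

lemma galois_perms_iso:
  assumes e: "bij_betw e {1..n} (complex_roots f)"
  shows "subgroup (galois_perms f n e) (sym_group n)"
    and "galois_group f \<cong> (sym_group n)\<lparr>carrier := galois_perms f n e\<rparr>"
    and "\<And>\<sigma>. \<sigma> \<in> carrier (galois_group f) \<Longrightarrow>
      \<exists>p\<in>galois_perms f n e. \<forall>i\<in>{1..n}. e (p i) = \<sigma> (e i)"
proof -
  let ?G = "galois_group f" and ?R = "complex_roots f"
  define \<Phi> where "\<Phi> \<sigma> = (\<lambda>i. if i \<in> {1..n} then inv_into {1..n} e (\<sigma> (e i)) else i)" for \<sigma>
  have ei: "e i \<in> ?R" if "i \<in> {1..n}" for i
    using bij_betwE[OF e] that by blast
  have \<Phi>_e: "\<Phi> \<sigma> i \<in> {1..n} \<and> e (\<Phi> \<sigma> i) = \<sigma> (e i)" if "\<sigma> \<in> carrier ?G" "i \<in> {1..n}" for \<sigma> i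
  proof -
    have "\<sigma> (e i) \<in> e ` {1..n}"
      using galois_root[OF that(1) ei[OF that(2)]] bij_betw_imp_surj_on[OF e] by simp
    then show ?thesis
      using that(2) inv_into_into[of "\<sigma> (e i)" e "{1..n}"] f_inv_into_f[of "\<sigma> (e i)" e "{1..n}"]
      by (simp add: \<Phi>_def)
  qed
  have e_inj: "i = j" if "e i = e j" "i \<in> {1..n}" "j \<in> {1..n}" for i j
    by (rule inj_onD[OF bij_betw_imp_inj_on[OF e] that])
  have perm: "\<Phi> \<sigma> permutes {1..n}" if s: "\<sigma> \<in> carrier ?G" for \<sigma>
  proof (rule bij_imp_permutes)
    have "inj_on (\<Phi> \<sigma>) {1..n}"
    proof (rule inj_onI)
      fix i j assume ij: "i \<in> {1..n}" "j \<in> {1..n}" "\<Phi> \<sigma> i = \<Phi> \<sigma> j"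
      then have "\<sigma> (e i) = \<sigma> (e j)" using \<Phi>_e[OF s ij(1)] \<Phi>_e[OF s ij(2)] by simp
      moreover have "e i \<in> splitting_set f" "e j \<in> splitting_set f"
        using ei[OF ij(1)] ei[OF ij(2)] roots_subset_splitting_set by blast+
      ultimately have "e i = e j"
        using inj_onD[OF galois_inj[OF s]] by blast
      then show "i = j" using ij(1,2) by (rule e_inj)
    qed
    then show "bij_betw (\<Phi> \<sigma>) {1..n} {1..n}"
      using \<Phi>_e[OF s] by (intro bij_betw_imageI endo_inj_surj) auto
    show "\<Phi> \<sigma> i = i" if "i \<notin> {1..n}" for i using that by (auto simp: \<Phi>_def)
  qed
  have img: "\<Phi> ` carrier ?G = galois_perms f n e"
  proof (intro equalityI subsetI)
    fix p assume "p \<in> \<Phi> ` carrier ?G"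
    then obtain \<sigma> where \<sigma>: "\<sigma> \<in> carrier ?G" "p = \<Phi> \<sigma>" by blast
    have "\<forall>i\<in>{1..n}. \<sigma> (e i) = e (\<Phi> \<sigma> i)" using \<Phi>_e[OF \<sigma>(1)] by simp
    then show "p \<in> galois_perms f n e"
      unfolding galois_perms_def using perm[OF \<sigma>(1)] \<sigma> by blast
  next
    fix p assume "p \<in> galois_perms f n e"
    then obtain \<sigma> where p: "p permutes {1..n}" "\<sigma> \<in> carrier ?G" "\<forall>i\<in>{1..n}. \<sigma> (e i) = e (p i)"
      by (auto simp: galois_perms_def)
    have "p i = \<Phi> \<sigma> i" for i
    proof (cases "i \<in> {1..n}")
      case True
      then show ?thesis
        using bspec[OF p(3) True] \<Phi>_e[OF p(2) True] permutes_in_image[OF p(1), of i]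
        by (intro e_inj) simp_all
    next
      case False
      then show ?thesis using p(1) by (auto simp: \<Phi>_def permutes_not_in)
    qed
    then have "p = \<Phi> \<sigma>" by (rule ext)
    then show "p \<in> \<Phi> ` carrier ?G" using p(2) by (rule image_eqI)
  qed
  have "\<Phi> \<in> hom ?G (sym_group n)"
  proof (rule homI)
    show "\<Phi> \<sigma> \<in> carrier (sym_group n)" if "\<sigma> \<in> carrier ?G" for \<sigma>
      using perm[OF that] by (simp add: sym_group_carrier)
    fix \<sigma> \<tau> assume st: "\<sigma> \<in> carrier ?G" "\<tau> \<in> carrier ?G"
    have c: "\<sigma> \<otimes>\<^bsub>?G\<^esub> \<tau> \<in> carrier ?G"
      using st group.is_monoid[OF galois_group_group] by (meson monoid.m_closed)
    have "\<Phi> (\<sigma> \<otimes>\<^bsub>?G\<^esub> \<tau>) i = \<Phi> \<sigma> (\<Phi> \<tau> i)" for i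
    proof (cases "i \<in> {1..n}")
      case True
      then have "e (\<Phi> (\<sigma> \<otimes>\<^bsub>?G\<^esub> \<tau>) i) = e (\<Phi> \<sigma> (\<Phi> \<tau> i))"
        using \<Phi>_e[OF c True] \<Phi>_e[OF st(1), of "\<Phi> \<tau> i"] \<Phi>_e[OF st(2) True] subsetD[OF roots_subset_splitting_set ei[OF True]]
        by (simp add: galois_comp[OF st] compose_def)
      then show ?thesis
        using \<Phi>_e[OF c True] \<Phi>_e[OF st(1)] \<Phi>_e[OF st(2) True] by (intro e_inj) simp_all
    next
      case False
      then show ?thesis by (auto simp: \<Phi>_def)
    qed
    then show "\<Phi> (\<sigma> \<otimes>\<^bsub>?G\<^esub> \<tau>) = \<Phi> \<sigma> \<otimes>\<^bsub>sym_group n\<^esub> \<Phi> \<tau>"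
      by (auto simp: sym_group_mult)
  qed
  then interpret h: group_hom ?G "sym_group n" \<Phi>
    using galois_group_group sym_group_is_group
    by (simp add: group_hom_def group_hom_axioms_def)
  show "subgroup (galois_perms f n e) (sym_group n)"
    using h.img_is_subgroup img by simp
  show "\<exists>p\<in>galois_perms f n e. \<forall>i\<in>{1..n}. e (p i) = \<sigma> (e i)"
    if "\<sigma> \<in> carrier ?G" for \<sigma>
  proof -
    have "\<Phi> \<sigma> \<in> galois_perms f n e"
      using imageI[OF that, of \<Phi>] by (simp only: img)
    moreover have "\<forall>i\<in>{1..n}. e (\<Phi> \<sigma> i) = \<sigma> (e i)" using \<Phi>_e[OF that] by simp
    ultimately show ?thesis by (intro bexI[of _ "\<Phi> \<sigma>"])
  qed
  have "inj_on \<Phi> (carrier ?G)"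
  proof (rule inj_onI)
    fix \<sigma> \<tau> assume st: "\<sigma> \<in> carrier ?G" "\<tau> \<in> carrier ?G" "\<Phi> \<sigma> = \<Phi> \<tau>"
    show "\<sigma> = \<tau>"
    proof (rule galois_eqI[OF st(1,2)])
      fix x assume "x \<in> ?R"
      then have "x \<in> e ` {1..n}" using bij_betw_imp_surj_on[OF e] by simp
      then obtain i where "i \<in> {1..n}" "x = e i" by blast
      then show "\<sigma> x = \<tau> x" using \<Phi>_e[OF st(1), of i] \<Phi>_e[OF st(2), of i] st(3) by simp
    qed
  qed
  then have "\<Phi> \<in> iso ?G ((sym_group n)\<lparr>carrier := galois_perms f n e\<rparr>)"
    using h.homh by (auto simp: iso_def hom_def bij_betw_def simp flip: img)
  then show "?G \<cong> (sym_group n)\<lparr>carrier := galois_perms f n e\<rparr>"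
    by (rule is_isoI)
qed

text \<open>Membership in a class that is defined by transitivity and isomorphism type does not depend on the
  numbering, so any numbering of the roots will do. It suffices to know the orbit of a single
  root \<open>z\<close>.\<close>

lemma galois_group_in_class_iso:
  assumes card: "card (complex_roots f) = n" and n: "n > 0"
    and z: "z \<in> complex_roots f"
    and orbit: "\<And>y. y \<in> complex_roots f \<Longrightarrow> \<exists>\<sigma>\<in>carrier (galois_group f). \<sigma> z = y"
    and iso: "galois_group f \<cong> G"
  shows "galois_group_in_class f n (transitive_subgroups_iso n G)"
proof -
  interpret G: group "galois_group f" by (rule galois_group_group)
  have trans: "\<exists>\<sigma>\<in>carrier (galois_group f). \<sigma> x = y"
    if x: "x \<in> complex_roots f" and y: "y \<in> complex_roots f" for x y
  proof -
    obtain \<sigma> \<tau> where st: "\<sigma> \<in> carrier (galois_group f)" "\<sigma> z = x"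
      "\<tau> \<in> carrier (galois_group f)" "\<tau> z = y"
      using orbit[OF x] orbit[OF y] by blast
    let ?\<rho> = "\<tau> \<otimes>\<^bsub>galois_group f\<^esub> inv\<^bsub>galois_group f\<^esub> \<sigma>"
    have \<rho>: "?\<rho> \<in> carrier (galois_group f)" using st by simp
    have "compose (splitting_set f) ?\<rho> \<sigma> = \<tau>"
      unfolding galois_comp[OF \<rho> st(1), symmetric] using st by (simp add: G.m_assoc)
    then have "compose (splitting_set f) ?\<rho> \<sigma> z = y"
      using st(4) by simp
    then have "?\<rho> x = y"
      using subsetD[OF roots_subset_splitting_set z] st(2) by (simp add: compose_def)
    then show ?thesis using \<rho> by blast
  qed
  have "finite (complex_roots f)" using card n by (intro card_ge_0_finite) simp
  then obtain e where e: "bij_betw e {1..n} (complex_roots f)"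
    using ex_bij_betw_nat_finite_1 card by blast
  note gp = galois_perms_iso[OF e]
  have "(sym_group n)\<lparr>carrier := galois_perms f n e\<rparr> \<cong> galois_group f"
    using group.iso_sym[OF galois_group_group gp(2)] .
  then have "(sym_group n)\<lparr>carrier := galois_perms f n e\<rparr> \<cong> G"
    using iso by (rule iso_trans)
  moreover have "\<exists>p\<in>galois_perms f n e. p i = j" if ij: "i \<in> {1..n}" "j \<in> {1..n}" for i j
  proof -
    have "e i \<in> complex_roots f" "e j \<in> complex_roots f"
      using e ij by (auto simp: bij_betw_def)
    then obtain \<sigma> where s: "\<sigma> \<in> carrier (galois_group f)" "\<sigma> (e i) = e j"
      using trans by blast
    obtain p where p: "p \<in> galois_perms f n e" "\<forall>k\<in>{1..n}. e (p k) = \<sigma> (e k)"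
      using gp(3)[OF s(1)] by blast
    have "p permutes {1..n}" using p(1) by (simp add: galois_perms_def)
    then have "p i \<in> {1..n}" using ij(1) permutes_in_image by metis
    moreover have "e (p i) = e j" using p(2) ij(1) s(2) by simp
    ultimately have "p i = j"
      using inj_onD[OF bij_betw_imp_inj_on[OF e]] ij(2) by blast
    then show ?thesis using p(1) by blast
  qed
  ultimately have "galois_perms f n e \<in> transitive_subgroups_iso n G"
    using gp(1) by (auto simp: transitive_subgroups_iso_def transitive_subgroups_def)
  then show ?thesis using e by (auto simp: galois_group_in_class_def)
qed

section \<open>Automorphisms from their graphs\<close>

text \<open>A subring \<open>R\<close> of \<open>\<complex> \<times> \<complex>\<close> in which \<open>0\<close> is related to \<open>0\<close> only is the graph of a ring homomorphism
  \<open>\<phi>\<close>. Here its domain is a field that contains the roots, so \<open>\<phi>\<close> is injective and permutes the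
  finitely many roots. Both the preimage and the image of the splitting field under \<open>\<phi>\<close> are then
  subfields that contain the roots, and minimality makes \<open>\<phi>\<close> a bijection of the splitting field.\<close>

lemma galois_from_graph:
  fixes R :: "(complex \<times> complex) set"
  assumes f0: "f \<noteq> 0"
    and add: "\<And>x x' y y'. (x, x') \<in> R \<Longrightarrow> (y, y') \<in> R \<Longrightarrow> (x + y, x' + y') \<in> R"
    and mult: "\<And>x x' y y'. (x, x') \<in> R \<Longrightarrow> (y, y') \<in> R \<Longrightarrow> (x * y, x' * y') \<in> R"
    and rat: "\<And>q. (of_rat q, of_rat q) \<in> R"
    and single: "\<And>y. (0, y) \<in> R \<Longrightarrow> y = 0"
    and inv: "\<And>x. x \<in> Domain R \<Longrightarrow> x \<noteq> 0 \<Longrightarrow> inverse x \<in> Domain R"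
    and roots: "complex_roots f \<subseteq> Domain R"
  shows "\<exists>\<sigma>\<in>carrier (galois_group f). \<forall>x\<in>splitting_set f. (x, \<sigma> x) \<in> R"
proof -
  let ?K = "splitting_set f"
  have neg: "(- x, - y) \<in> R" if "(x, y) \<in> R" for x y
    using mult[OF rat[of "-1"] that] by simp
  have uniq: "y = y'" if "(x, y) \<in> R" "(x, y') \<in> R" for x y y'
    using single[of "y - y'"] add[OF that(1) neg[OF that(2)]] by simp
  have one: "(1, 1) \<in> R" using rat[of 1] by simp
  define \<phi> where "\<phi> x = (THE y. (x, y) \<in> R)" for x
  have \<phi>: "\<phi> x = y" if "(x, y) \<in> R" for x y
    unfolding \<phi>_def by (rule the_equality) (use that uniq in blast)+
  have \<phi>R: "(x, \<phi> x) \<in> R" if "x \<in> Domain R" for x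
    using that \<phi> by blast
  have D: "x + y \<in> Domain R" "x * y \<in> Domain R" "\<phi> (x + y) = \<phi> x + \<phi> y" "\<phi> (x * y) = \<phi> x * \<phi> y"
    if "x \<in> Domain R" "y \<in> Domain R" for x y
    using add[OF \<phi>R \<phi>R, OF that] mult[OF \<phi>R \<phi>R, OF that] \<phi> by blast+
  have Dneg: "- x \<in> Domain R" "\<phi> (- x) = - \<phi> x" if "x \<in> Domain R" for x
    using neg[OF \<phi>R[OF that]] \<phi> by blast+
  have \<phi>rat: "\<phi> (of_rat q) = of_rat q" for q
    by (rule \<phi>[OF rat])
  have \<phi>1: "\<phi> 1 = 1" and \<phi>0: "\<phi> 0 = 0" using \<phi>rat[of 1] \<phi>rat[of 0] by simp_all
  have \<phi>inv: "\<phi> (inverse x) = inverse (\<phi> x)" if "x \<in> Domain R" for x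
  proof (cases "x = 0")
    case True
    then show ?thesis by (simp add: \<phi>0)
  next
    case False
    then have "\<phi> x * \<phi> (inverse x) = 1"
      using D(4)[OF that inv[OF that]] \<phi>1 by simp
    then show ?thesis by (metis inverse_unique)
  qed
  have Dinv: "inverse x \<in> Domain R" if "x \<in> Domain R" for x
    using inv[OF that] that by (cases "x = 0") auto
  have \<phi>nz: "x = 0" if "x \<in> Domain R" "\<phi> x = 0" for x
  proof (rule ccontr)
    assume "x \<noteq> 0"
    then show False using D(4)[OF that(1) inv[OF that(1)]] \<phi>1 that(2) by simp
  qed
  have \<phi>inj: "inj_on \<phi> (Domain R)"
  proof (rule inj_onI)
    fix x y assume xy: "x \<in> Domain R" "y \<in> Domain R" "\<phi> x = \<phi> y"
    then have "\<phi> (x + - y) = 0"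
      using D(3)[OF xy(1) Dneg(1)[OF xy(2)]] Dneg(2)[OF xy(2)] by simp
    then show "x = y" using \<phi>nz[OF D(1)[OF xy(1) Dneg(1)[OF xy(2)]]] by simp
  qed
  have Dfield: "subfield (Domain R) ring_of_type_algebra"
    by (rule subfield_complexI) (use DomainI[OF one] D(1,2) Dneg(1) inv in blast)+
  have KD: "?K \<subseteq> Domain R"
    by (rule splitting_set_minimal[OF Dfield roots])
  have \<phi>q: "qeval g x \<in> Domain R \<and> \<phi> (qeval g x) = qeval g (\<phi> x)" if x: "x \<in> Domain R" for g x
  proof (induction g)
    case 0
    show ?case using \<phi>0 rat[of 0] by auto
  next
    case (pCons c g)
    have "of_rat c \<in> Domain R" using rat by blast
    then show ?case using pCons x D \<phi>rat by simp
  qed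
  have \<phi>roots: "\<phi> x \<in> complex_roots f" if "x \<in> complex_roots f" for x
    using \<phi>q[of x f] that roots \<phi>0 by (auto simp: complex_roots_def)
  have fin: "finite (complex_roots f)"
    using f0 unfolding complex_roots_def
    by (intro poly_roots_finite) (simp add: map_poly_eq_0_iff)
  have "\<phi> ` complex_roots f = complex_roots f"
    by (rule endo_inj_surj[OF fin]) (use \<phi>roots inj_on_subset[OF \<phi>inj roots] in auto)
  then have surj: "complex_roots f \<subseteq> \<phi> ` ?K"
    using roots_subset_splitting_set by blast
  have "subfield {x \<in> Domain R. \<phi> x \<in> ?K} ring_of_type_algebra"
    by (rule subfield_complexI)
      (use one DomainI[OF one] in \<open>auto simp: D Dneg Dinv \<phi>inv \<phi>1 splitting_set_closed
        simp del: Domain_iff\<close>)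
  then have into: "\<phi> x \<in> ?K" if "x \<in> ?K" for x
    using splitting_set_minimal[of "{x \<in> Domain R. \<phi> x \<in> ?K}" f] that roots \<phi>roots
      roots_subset_splitting_set[of f] by blast
  have "subfield (\<phi> ` ?K) ring_of_type_algebra"
  proof (rule subfield_complexI)
    have K: "\<phi> x \<in> \<phi> ` ?K" if "x \<in> ?K" for x using that by blast
    show "1 \<in> \<phi> ` ?K" using K[OF splitting_set_closed(1)] \<phi>1 by simp
    fix x assume "x \<in> \<phi> ` ?K"
    then obtain x' where x: "x' \<in> ?K" "x' \<in> Domain R" "x = \<phi> x'" using KD by blast
    show "- x \<in> \<phi> ` ?K"
      using K[OF splitting_set_closed(4)[OF x(1)]] Dneg(2)[OF x(2)] x(3) by simp
    show "inverse x \<in> \<phi> ` ?K"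
      using K[OF splitting_set_closed(5)[OF x(1)]] \<phi>inv[OF x(2)] x(3) by simp
    fix y assume "y \<in> \<phi> ` ?K"
    then obtain y' where y: "y' \<in> ?K" "y' \<in> Domain R" "y = \<phi> y'" using KD by blast
    show "x + y \<in> \<phi> ` ?K"
      using K[OF splitting_set_closed(2)[OF x(1) y(1)]] D(3)[OF x(2) y(2)] x(3) y(3) by simp
    show "x * y \<in> \<phi> ` ?K"
      using K[OF splitting_set_closed(3)[OF x(1) y(1)]] D(4)[OF x(2) y(2)] x(3) y(3) by simp
  qed
  then have "?K \<subseteq> \<phi> ` ?K"
    using splitting_set_minimal surj by blast
  then have bij: "bij_betw \<phi> ?K ?K"
    using into inj_on_subset[OF \<phi>inj KD] by (auto simp: bij_betw_def)
  have "restrict \<phi> ?K \<in> carrier (galois_group f)"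
    unfolding galois_group_iff
    using bij KD \<phi>rat D(3,4) splitting_set_closed
    by (auto simp: Bij_def bij_betw_restrict_eq subset_iff)
  moreover have "\<forall>x\<in>?K. (x, restrict \<phi> ?K x) \<in> R"
  proof
    fix x assume x: "x \<in> ?K"
    show "(x, restrict \<phi> ?K x) \<in> R" using \<phi>R[OF subsetD[OF KD x]] x by simp
  qed
  ultimately show ?thesis by blast
qed

section \<open>Simple extensions\<close>

text \<open>If \<open>f\<close> did not divide \<open>g\<close>, the two would be coprime, and evaluating a Bezout identity at the common
  root would give \<open>0 = 1\<close>.\<close>

lemma irreducible_dvd_of_common_root:
  assumes irr: "Factorial_Ring.irreducible f" and "qeval f z = 0" "qeval g z = 0"
  shows "f dvd g"
proof (rule ccontr)
  assume "\<not> f dvd g"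
  then have "coprime f g"
    using irr by (simp add: irreducible_imp_prime_elem prime_elem_imp_coprime)
  then obtain p r where "p * f + r * g = 1"
    using bezout_coefficients_fst_snd[of f g] by (metis coprime_iff_gcd_eq_1)
  then have "qeval (p * f + r * g) z = 1" by simp
  then show False using assms(2,3) by simp
qed

text \<open>The inverse is the value at \<open>z\<close> of the Bezout coefficient of \<open>g\<close>.\<close>

lemma simple_extension_inverse:
  assumes irr: "Factorial_Ring.irreducible f" and z: "qeval f z = 0" and g: "qeval g z \<noteq> 0"
  shows "\<exists>h. qeval h z = inverse (qeval g z)"
proof -
  have "\<not> f dvd g" using z g by (auto elim!: dvdE)
  then have "coprime f g"
    using irr by (simp add: irreducible_imp_prime_elem prime_elem_imp_coprime)
  then obtain p r where "p * f + r * g = 1"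
    using bezout_coefficients_fst_snd[of f g] by (metis coprime_iff_gcd_eq_1)
  then have "qeval (p * f + r * g) z = 1" by simp
  then have "qeval r z = inverse (qeval g z)" using z g by (simp add: field_simps)
  then show ?thesis by blast
qed

lemma subfield_simple_extension:
  assumes irr: "Factorial_Ring.irreducible f" and z: "qeval f z = 0"
  shows "subfield (range (\<lambda>g. qeval g z)) ring_of_type_algebra"
proof (rule subfield_complexI)
  let ?L = "range (\<lambda>g. qeval g z)"
  have L: "qeval g z \<in> ?L" for g by blast
  show "1 \<in> ?L" using L[of 1] by simp
  fix x assume "x \<in> ?L"
  then obtain g where g: "x = qeval g z" by blast
  show "- x \<in> ?L" using L[of "- g"] g by simp
  show "inverse x \<in> ?L" if "x \<noteq> 0"
    using simple_extension_inverse[OF irr z, of g] L that g by metis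
  fix y assume "y \<in> ?L"
  then obtain h where h: "y = qeval h z" by blast
  show "x + y \<in> ?L" using L[of "g + h"] g h by simp
  show "x * y \<in> ?L" using L[of "g * h"] g h by simp
qed

text \<open>The graph \<open>{(g z, g y)}\<close>, for \<open>g\<close> ranging over the rational polynomials, is single-valued because
  \<open>g z = 0\<close> forces \<open>f dvd g\<close> and hence \<open>g y = 0\<close>.\<close>

lemma galois_transitive_simple:
  assumes irr: "Factorial_Ring.irreducible f"
    and z: "z \<in> complex_roots f" and y: "y \<in> complex_roots f"
    and gen: "complex_roots f \<subseteq> range (\<lambda>g. qeval g z)"
  shows "\<exists>\<sigma>\<in>carrier (galois_group f). \<sigma> z = y"
proof -
  let ?R = "{(qeval g z, qeval g y) | g. True}"
  have z0: "qeval f z = 0" and y0: "qeval f y = 0" using z y by (auto simp: complex_roots_def)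
  have single: "c = 0" if "(0, c) \<in> ?R" for c
    using irreducible_dvd_of_common_root[OF irr z0] y0 that by (force elim!: dvdE)
  have "\<exists>\<sigma>\<in>carrier (galois_group f). \<forall>x\<in>splitting_set f. (x, \<sigma> x) \<in> ?R"
  proof (rule galois_from_graph)
    show "f \<noteq> 0" using irr by auto
    show "(x + c, x' + c') \<in> ?R" if "(x, x') \<in> ?R" "(c, c') \<in> ?R" for x x' c c'
      using that by clarsimp (metis qeval_add)
    show "(x * c, x' * c') \<in> ?R" if "(x, x') \<in> ?R" "(c, c') \<in> ?R" for x x' c c'
      using that by clarsimp (metis qeval_mult)
    show "(of_rat q, of_rat q) \<in> ?R" for q
      by clarsimp (rule exI[of _ "[:q:]"], simp)
    show "inverse x \<in> Domain ?R" if "x \<in> Domain ?R" "x \<noteq> 0" for x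
    proof -
      from that obtain g where "x = qeval g z" by blast
      then obtain h where "inverse x = qeval h z"
        using simple_extension_inverse[OF irr z0] \<open>x \<noteq> 0\<close> by metis
      then show ?thesis by blast
    qed
    show "complex_roots f \<subseteq> Domain ?R"
      using gen by (force simp: Domain_unfold)
  qed (rule single)
  then obtain \<sigma> where s: "\<sigma> \<in> carrier (galois_group f)"
    "\<forall>x\<in>splitting_set f. (x, \<sigma> x) \<in> ?R" by blast
  then obtain g where "z = qeval g z" "\<sigma> z = qeval g y"
    using z roots_subset_splitting_set by blast
  then have "(0, \<sigma> z - y) \<in> ?R"
    by clarsimp (rule exI[of _ "g + - [:0, 1:]"], simp)
  then have "\<sigma> z = y" using single[of "\<sigma> z - y"] by simp
  then show ?thesis using s(1) by blast
qed

text \<open>If the splitting field is a proper quadratic extension \<open>\<rat>(z)(w)\<close> with \<open>w\<^sup>2\<close> rational, then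
  \<open>g z + h z * w \<mapsto> g y + h y * (\<eta> * w)\<close> is well defined for each sign \<open>\<eta>\<close>, because \<open>1\<close> and \<open>w\<close> are linearly
  independent over \<open>\<rat>(z)\<close>. So the image of \<open>z\<close> and the sign of \<open>w\<close> can be chosen independently.\<close>

lemma galois_transitive_quadratic:
  fixes w :: complex
  assumes irr: "Factorial_Ring.irreducible f"
    and z: "z \<in> complex_roots f" and y: "y \<in> complex_roots f"
    and w: "w\<^sup>2 = of_rat q" "w \<notin> range (\<lambda>g. qeval g z)" "w \<in> splitting_set f"
    and gen: "\<And>x. x \<in> complex_roots f \<Longrightarrow> \<exists>g h. x = qeval g z + qeval h z * w"
    and \<eta>: "\<eta>\<^sup>2 = 1"
  shows "\<exists>\<sigma>\<in>carrier (galois_group f). \<sigma> z = y \<and> \<sigma> w = \<eta> * w"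
proof -
  let ?L = "range (\<lambda>g. qeval g z)"
  let ?R = "{(qeval g z + qeval h z * w, qeval g y + qeval h y * (\<eta> * w)) | g h. True}"
  have z0: "qeval f z = 0" and y0: "qeval f y = 0" using z y by (auto simp: complex_roots_def)
  note L = subfield_simple_extension[OF irr z0]
  have ww: "w * w = of_rat q" "\<eta> * w * (\<eta> * w) = of_rat q"
    using w(1) \<eta> by (simp_all add: power2_eq_square algebra_simps)
  have lin: "qeval g z = 0 \<and> qeval h z = 0" if gh: "qeval g z + qeval h z * w = 0" for g h
  proof (cases "qeval h z = 0")
    case True
    then show ?thesis using gh by simp
  next
    case False
    have "- qeval g z * inverse (qeval h z) \<in> ?L"
      by (intro subfield_complex_mult[OF L] subfield_complex_uminus[OF L]
          subfield_complex_inverse[OF L]) auto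
    moreover have "w = - qeval g z * inverse (qeval h z)"
      using False gh by (simp add: field_simps add_eq_0_iff2)
    ultimately show ?thesis using w(2) by simp
  qed
  have vanish: "qeval g y = 0" if "qeval g z = 0" for g
    using irreducible_dvd_of_common_root[OF irr z0 that] y0 by (auto elim!: dvdE)
  have single: "c = 0" if "(0, c) \<in> ?R" for c
  proof -
    from that obtain g h where gh: "0 = qeval g z + qeval h z * w"
      "c = qeval g y + qeval h y * (\<eta> * w)" by blast
    then show ?thesis using lin[of g h] vanish by simp
  qed
  have R: "(qeval g z + qeval h z * w, qeval g y + qeval h y * (\<eta> * w)) \<in> ?R" for g h by blast
  have "\<exists>\<sigma>\<in>carrier (galois_group f). \<forall>x\<in>splitting_set f. (x, \<sigma> x) \<in> ?R"
  proof (rule galois_from_graph)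
    show "f \<noteq> 0" using irr by auto
    show "(x + c, x' + c') \<in> ?R" if "(x, x') \<in> ?R" "(c, c') \<in> ?R" for x x' c c'
    proof -
      from that obtain g h g' h' where
        "x = qeval g z + qeval h z * w" "x' = qeval g y + qeval h y * (\<eta> * w)"
        "c = qeval g' z + qeval h' z * w" "c' = qeval g' y + qeval h' y * (\<eta> * w)" by blast
      then show ?thesis using R[of "g + g'" "h + h'"] by (simp add: algebra_simps)
    qed
    show "(x * c, x' * c') \<in> ?R" if "(x, x') \<in> ?R" "(c, c') \<in> ?R" for x x' c c'
    proof -
      from that obtain g h g' h' where e:
        "x = qeval g z + qeval h z * w" "x' = qeval g y + qeval h y * (\<eta> * w)"
        "c = qeval g' z + qeval h' z * w" "c' = qeval g' y + qeval h' y * (\<eta> * w)" by blast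
      have m: "(A + B * r) * (C + D * r) = (A * C + of_rat q * (B * D)) + (A * D + B * C) * r"
        if "r * r = of_rat q" for A B C D r :: complex
        by (simp add: algebra_simps flip: that)
      show ?thesis using R[of "g * g' + smult q (h * h')" "g * h' + h * g'"]
        unfolding e m[OF ww(1)] m[OF ww(2)] by simp
    qed
    show "(of_rat r, of_rat r) \<in> ?R" for r
      using R[of "[:r:]" 0] by simp
    show "inverse x \<in> Domain ?R" if x: "x \<in> Domain ?R" "x \<noteq> 0" for x
    proof -
      from x obtain g h where e: "x = qeval g z + qeval h z * w" by auto
      \<comment> \<open>Multiplying by the conjugate brings the denominator into \<open>\<rat>(z)\<close>.\<close>
      let ?c = "qeval g z + qeval (- h) z * w"
      have "?c \<noteq> 0" using lin[of g "- h"] x(2) e by auto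
      have n: "x * ?c = qeval (g * g + smult (- q) (h * h)) z"
      proof -
        have m: "(A + B * w) * (A + - B * w) = A * A + of_rat (- q) * (B * B)" for A B
          by (simp add: algebra_simps of_rat_minus flip: ww(1))
        show ?thesis unfolding e qeval_minus m by (simp only: qeval_add qeval_mult qeval_smult)
      qed
      have nz: "x * ?c \<noteq> 0" using x(2) \<open>?c \<noteq> 0\<close> by simp
      then obtain k where k: "qeval k z = inverse (x * ?c)"
        using simple_extension_inverse[OF irr z0] unfolding n by blast
      have "inverse x = ?c * inverse (x * ?c)"
        unfolding inverse_mult_distrib using \<open>?c \<noteq> 0\<close> by (simp only: ac_simps) simp
      also have "\<dots> = qeval (g * k) z + qeval (- h * k) z * w"
        unfolding k[symmetric] qeval_mult by (simp only: algebra_simps)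
      finally have i: "inverse x = qeval (g * k) z + qeval (- h * k) z * w" .
      show ?thesis unfolding i using R[of "g * k" "- h * k"] by (rule DomainI)
    qed
    show "complex_roots f \<subseteq> Domain ?R"
      using gen R by blast
  qed (rule single)
  then obtain \<sigma> where s: "\<sigma> \<in> carrier (galois_group f)"
    "\<forall>x\<in>splitting_set f. (x, \<sigma> x) \<in> ?R" by blast
  have uniq: "\<sigma> x = x'" if "x \<in> splitting_set f" "(x, x') \<in> ?R" for x x'
  proof -
    from s(2) that obtain g h g' h' where e:
      "x = qeval g z + qeval h z * w" "\<sigma> x = qeval g y + qeval h y * (\<eta> * w)"
      "x = qeval g' z + qeval h' z * w" "x' = qeval g' y + qeval h' y * (\<eta> * w)" by blast
    have "(0, \<sigma> x - x') \<in> ?R"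
    proof -
      have "qeval (g - g') z + qeval (h - h') z * w = x - x"
        by (subst (1) e(1), subst e(3)) (simp add: algebra_simps)
      moreover have "qeval (g - g') y + qeval (h - h') y * (\<eta> * w) = \<sigma> x - x'"
        by (subst e(2), subst e(4)) (simp add: algebra_simps)
      ultimately show ?thesis using R[of "g - g'" "h - h'"] by simp
    qed
    then have "\<sigma> x - x' = 0" by (rule single)
    then show ?thesis by simp
  qed
  have "(z, y) \<in> ?R" using R[of "[:0, 1:]" 0] by simp
  then have "\<sigma> z = y"
    using subsetD[OF roots_subset_splitting_set z] by (intro uniq)
  moreover have "(w, \<eta> * w) \<in> ?R" using R[of 0 "[:1:]"] by simp
  then have "\<sigma> w = \<eta> * w" by (rule uniq[OF w(3)])
  ultimately show ?thesis using s(1) by blast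
qed

text \<open>Write \<open>x = g z\<close> and replace \<open>g\<close> by its remainder modulo \<open>f\<close>. By transitivity the remainder takes the
  value \<open>x\<close> at all roots of \<open>f\<close>, which are more than its degree, so it is constant.\<close>

lemma fixed_imp_rational:
  assumes x: "x = qeval g z" and zr: "z \<in> complex_roots f"
    and f0: "f \<noteq> 0" and card: "degree f \<le> card (complex_roots f)"
    and trans: "\<And>y. y \<in> complex_roots f \<Longrightarrow> \<exists>\<sigma>\<in>carrier (galois_group f). \<sigma> z = y"
    and fixed: "\<And>\<sigma>. \<sigma> \<in> carrier (galois_group f) \<Longrightarrow> \<sigma> x = x"
  shows "x \<in> \<rat>"
proof -
  have deg: "degree f > 0"
  proof (rule ccontr)
    assume "\<not> ?thesis"
    then obtain c where "f = [:c:]" by (metis degree_eq_zeroE neq0_conv)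
    then show False using zr f0 by (simp add: complex_roots_def)
  qed
  let ?h = "g mod f"
  have h: "qeval ?h y = x" if y: "y \<in> complex_roots f" for y
  proof -
    obtain \<sigma> where s: "\<sigma> \<in> carrier (galois_group f)" "\<sigma> z = y" using trans y by blast
    have "qeval g y = x"
      using galois_qeval[OF s(1), of z g] fixed[OF s(1)] x s(2) zr roots_subset_splitting_set[of f]
      by auto
    moreover have "qeval g y = qeval (g div f * f + ?h) y" by simp
    then have "qeval g y = qeval ?h y"
      using y by (simp only: qeval_add qeval_mult) (simp add: complex_roots_def)
    ultimately show ?thesis by simp
  qed
  let ?p = "map_poly of_rat ?h - [:x:]"
  have "degree ?h < degree f"
    using deg f0 degree_mod_less' [of f g] by (cases "?h = 0") auto
  then have "degree ?p < degree f"
    using deg by (intro degree_diff_less) (simp_all add: degree_map_poly)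
  moreover have "complex_roots f \<subseteq> {y. poly ?p y = 0}" using h by auto
  ultimately have "?p = 0"
    using card_poly_roots_bound[of ?p] card card_mono[OF poly_roots_finite[of ?p]]
    by (metis (no_types, lifting) le_trans not_less)
  then have "coeff ?p 0 = 0" by simp
  then have "x = of_rat (coeff ?h 0)" by (simp add: coeff_map_poly)
  then show ?thesis by simp
qed

section \<open>Signs and rational squares\<close>

lemma rat_squares_iff:
  assumes "(z :: complex)\<^sup>2 = of_rat r"
  shows "of_rat r \<in> rat_squares \<longleftrightarrow> z \<in> \<rat>"
proof
  assume "of_rat r \<in> rat_squares"
  then obtain k where "(of_rat r :: real) = of_rat (k\<^sup>2)"
    by (auto simp: rat_squares_def of_rat_power)
  then have "r = k\<^sup>2" by (simp only: of_rat_eq_iff)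
  then have "z\<^sup>2 = (of_rat k)\<^sup>2" using assms by (simp add: of_rat_power)
  then show "z \<in> \<rat>" by (auto simp: power2_eq_iff)
next
  assume "z \<in> \<rat>"
  then obtain k where "z = of_rat k" by (auto elim: Rats_cases)
  then have "of_rat r = (of_rat (k\<^sup>2) :: complex)" using assms by (simp add: of_rat_power)
  then have "r = k\<^sup>2" by (simp only: of_rat_eq_iff)
  then show "of_rat r \<in> rat_squares" by (auto simp: rat_squares_def of_rat_power)
qed

text \<open>The law satisfied by the sign bit \<open>h = H j e d\<close> when it is determined by the other three bits. On
  \<open>j = False\<close> the function \<open>H\<close> is additive, so \<open>H False e d = (\<alpha> \<and> e) \<noteq> (\<beta> \<and> d)\<close>. Multiplying by an
  element with \<open>j = True\<close> from the left and from the right gives two expressions for the same value,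
  and comparing them yields \<open>\<alpha> = \<beta>\<close>.\<close>

lemma twisted_additive_bool:
  fixes H :: "bool \<Rightarrow> bool \<Rightarrow> bool \<Rightarrow> bool"
  assumes H: "\<And>j e d j' e' d'. H (j \<noteq> j') (e \<noteq> (e' \<noteq> (j' \<and> H j e d))) (d \<noteq> (d' \<noteq> (j' \<and> H j e d)))
     = (H j e d \<noteq> H j' e' d')"
  shows "\<exists>\<alpha> \<gamma>. \<forall>j e d. H j e d = ((\<alpha> \<and> e \<noteq> d) \<noteq> (\<gamma> \<and> j))"
proof -
  have 0: "H False (e \<noteq> e') (d \<noteq> d') = (H False e d \<noteq> H False e' d')" for e d e' d'
    using H[of False False e e' d d'] by simp
  have 1: "H True e d = (H True False False \<noteq> H False e d)" for e d
    using H[of True False False e False d] by simp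
  have 2: "H True (e \<noteq> H False e d) (d \<noteq> H False e d) = (H False e d \<noteq> H True False False)" for e d
    using H[of False True e False d False] by simp
  have FF: "H False False False = False" using 0[of False False False False] by auto
  have TT: "H False True True = (H False True False \<noteq> H False False True)"
    using 0[of True False False True] by simp
  have eq: "H False True False = H False False True"
    using 1[of False True] 1[of True False] 2[of True False] 2[of False True] FF
    by (cases "H False True False"; cases "H False False True") simp_all
  have "H j e d = ((H False True False \<and> e \<noteq> d) \<noteq> (H True False False \<and> j))" for j e d
    using FF TT eq 1[of e d] by (cases j; cases e; cases d) auto
  then show ?thesis by blast
qed

definition sg :: "bool \<Rightarrow> complex"
  where "sg x = (if x then - 1 else 1)"

lemma sg_simps [simp]: "sg False = 1" "sg True = - 1" "sg x * sg x = 1" "sg x \<noteq> 0" "(sg x)\<^sup>2 = 1"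
  by (auto simp: sg_def)

lemma sg_mult: "sg x * sg y = sg (x \<noteq> y)"
  by (auto simp: sg_def)

lemma sg_rat: "sg x = of_rat (if x then - 1 else 1)"
  by (simp add: sg_def)

lemma square_eq_sg:
  assumes "x\<^sup>2 = (y :: complex)\<^sup>2"
  shows "x = sg (x \<noteq> y) * y"
  using assms by (auto simp: power2_eq_iff sg_def)

lemma sg_cancel: "y \<noteq> 0 \<Longrightarrow> sg e * y = sg e' * y \<longleftrightarrow> e = e'"
  by (auto simp: sg_def)

section \<open>The roots of a reciprocal octic\<close>

abbreviation octic :: "rat \<Rightarrow> rat \<Rightarrow> rat poly"
  where "octic a b \<equiv> [:1, 0, a, 0, b, 0, a, 0, 1:]"

text \<open>The truth values index the two roots \<open>u False\<close>, \<open>u True\<close> of \<open>t\<^sup>2 + a * t + b - 2\<close>. The signs of the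
  square roots \<open>P j\<close> and \<open>M j\<close> are only constrained by the last equation; prescribing their product
  as a rational number is what makes the action of an automorphism on \<open>P True\<close> and \<open>M True\<close> depend on
  its action on \<open>P False\<close>, \<open>M False\<close> and \<open>w\<close>.\<close>

locale reciprocal_octic =
  fixes a b s :: rat and u P M :: "bool \<Rightarrow> complex"
  assumes irr: "Factorial_Ring.irreducible (octic a b)"
    and s: "s\<^sup>2 = (b + 2)\<^sup>2 - 4 * a\<^sup>2"
    and u_sum: "u False + u True = - of_rat a"
    and u_prod: "u False * u True = of_rat b - 2"
    and P_sq: "\<And>i. (P i)\<^sup>2 = u i + 2"
    and M_sq: "\<And>i. (M i)\<^sup>2 = u i - 2"
    and PM_prod: "P False * P True * M False * M True = of_rat s"
begin

abbreviation "f \<equiv> octic a b"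
abbreviation "K \<equiv> splitting_set f"
abbreviation "G \<equiv> carrier (galois_group f)"

definition w :: complex where "w = M False * M True"
definition \<delta> :: complex where "\<delta> = u False - u True"

definition octic_root :: "bool \<Rightarrow> bool \<Rightarrow> bool \<Rightarrow> complex"
  where "octic_root j e d = (sg e * P j + sg d * M j) / 2"

lemma octic_factor: "qeval f x = (x ^ 4 - u False * x\<^sup>2 + 1) * (x ^ 4 - u True * x\<^sup>2 + 1)"
proof -
  have a: "of_rat a = - (u False + u True)" using u_sum by simp
  have b: "of_rat b = u False * u True + 2" using u_prod by simp
  show ?thesis by (simp add: a b algebra_simps power_numeral_reduce)
qed

lemma quartic_factor:
  "x ^ 4 - u j * x\<^sup>2 + 1 = (x - octic_root j False False) * (x - octic_root j False True) *
    ((x - octic_root j True False) * (x - octic_root j True True))"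
proof -
  have PM: "(P j)\<^sup>2 - (M j)\<^sup>2 = 4" using P_sq[of j] M_sq[of j] by simp
  have "(x - octic_root j False False) * (x - octic_root j False True)
      = x\<^sup>2 - P j * x + ((P j)\<^sup>2 - (M j)\<^sup>2) / 4"
    by (simp add: octic_root_def field_simps power2_eq_square)
  moreover have "(x - octic_root j True False) * (x - octic_root j True True)
      = x\<^sup>2 + P j * x + ((P j)\<^sup>2 - (M j)\<^sup>2) / 4"
    by (simp add: octic_root_def field_simps power2_eq_square)
  moreover have "x ^ 4 - u j * x\<^sup>2 + 1 = (x\<^sup>2 - P j * x + 1) * (x\<^sup>2 + P j * x + 1)"
  proof -
    have u: "u j = (P j)\<^sup>2 - 2" using P_sq[of j] by simp
    show ?thesis unfolding u by (simp add: algebra_simps power2_eq_square power_numeral_reduce)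
  qed
  ultimately show ?thesis unfolding PM by simp
qed

lemma complex_roots_eq: "complex_roots f = range (\<lambda>(j, e, d). octic_root j e d)"
proof -
  have "x \<in> complex_roots f \<longleftrightarrow> (\<exists>j e d. x = octic_root j e d)" for x
    unfolding complex_roots_def mem_Collect_eq octic_factor quartic_factor mult_eq_0_iff
      right_minus_eq ex_bool_eq by blast
  then show ?thesis by (auto simp: image_iff)
qed

lemma root_in_roots: "octic_root j e d \<in> complex_roots f"
  unfolding complex_roots_eq by (rule range_eqI[of _ _ "(j, e, d)"]) simp

lemma rootE:
  assumes "x \<in> complex_roots f"
  obtains j e d where "x = octic_root j e d"
  using assms unfolding complex_roots_eq by auto

text \<open>All degeneracies are excluded by irreducibility in this form: each of them would make a root
  of \<open>f\<close> satisfy an equation of degree 2 or 4.\<close>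

lemma root_not_small_degree:
  assumes "g \<noteq> 0" "degree g < 8"
  shows "qeval g (octic_root j e d) \<noteq> 0"
proof
  assume "qeval g (octic_root j e d) = 0"
  moreover have "qeval f (octic_root j e d) = 0"
    using root_in_roots by (simp add: complex_roots_def)
  ultimately have "f dvd g" using irreducible_dvd_of_common_root[OF irr] by blast
  then have "degree f \<le> degree g" using assms(1) by (rule dvd_imp_degree_le)
  then show False using assms(2) by simp
qed

lemma P_nonzero: "P j \<noteq> 0"
proof
  assume 0: "P j = 0"
  then have "u j = - 2" using P_sq[of j] by (simp add: add_eq_0_iff2)
  then have "(M j)\<^sup>2 = - 4" using M_sq[of j] by simp
  then have "qeval [:1, 0, 1:] (octic_root j False False) = 0"
    using 0 by (simp add: octic_root_def power2_eq_square)
  then show False using root_not_small_degree[of "[:1, 0, 1:]"] by simp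
qed

lemma M_nonzero: "M j \<noteq> 0"
proof
  assume 0: "M j = 0"
  then have "u j = 2" using M_sq[of j] by simp
  then have "(P j)\<^sup>2 = 4" using P_sq[of j] by simp
  then have "qeval [:- 1, 0, 1:] (octic_root j False False) = 0"
    using 0 by (simp add: octic_root_def power2_eq_square of_rat_minus)
  then show False using root_not_small_degree[of "[:- 1, 0, 1:]"] by simp
qed

lemma \<delta>_nonzero: "\<delta> \<noteq> 0"
proof
  assume "\<delta> = 0"
  then have u: "of_rat a = - 2 * u False" using u_sum by (simp add: \<delta>_def eq_neg_iff_add_eq_0 add.commute)
  have "(octic_root False False False) ^ 4 - u False * (octic_root False False False)\<^sup>2 + 1 = 0"
    unfolding quartic_factor by simp
  then have "qeval [:1, 0, a / 2, 0, 1:] (octic_root False False False) = 0"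
    by (simp add: of_rat_divide u power2_eq_square power_numeral_reduce algebra_simps)
  then show False using root_not_small_degree[of "[:1, 0, a / 2, 0, 1:]"] by simp
qed

lemma u_inj: "u i = u j \<longleftrightarrow> i = j"
  using \<delta>_nonzero by (cases i; cases j) (auto simp: \<delta>_def)

lemma root_reciprocal: "octic_root j e d * octic_root j e (\<not> d) = 1"
proof -
  have "octic_root j e d * octic_root j e (\<not> d) = ((P j)\<^sup>2 - (M j)\<^sup>2) / 4"
    by (cases e; cases d) (simp_all add: octic_root_def field_simps power2_eq_square)
  then show ?thesis using P_sq[of j] M_sq[of j] by simp
qed

lemma inverse_root: "inverse (octic_root j e d) = octic_root j e (\<not> d)"
  using root_reciprocal[of j e d] by (metis inverse_unique)

lemma root_plus_inverse: "octic_root j e d + inverse (octic_root j e d) = sg e * P j"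
  unfolding inverse_root by (cases d) (simp_all add: octic_root_def field_simps)

lemma root_minus_inverse: "octic_root j e d - inverse (octic_root j e d) = sg d * M j"
  unfolding inverse_root by (cases d) (simp_all add: octic_root_def field_simps)

text \<open>A root determines \<open>\<plusminus> P j\<close> and \<open>\<plusminus> M j\<close> as its sum and difference with its inverse.\<close>

lemma root_inj:
  assumes "octic_root j e d = octic_root j' e' d'"
  shows "j = j' \<and> e = e' \<and> d = d'"
proof -
  have P: "sg e * P j = sg e' * P j'" and M: "sg d * M j = sg d' * M j'"
    using root_plus_inverse[of j e d] root_plus_inverse[of j' e' d']
      root_minus_inverse[of j e d] root_minus_inverse[of j' e' d'] assms by simp_all
  have "(P j)\<^sup>2 = (P j')\<^sup>2" using arg_cong[OF P, of "\<lambda>x. x\<^sup>2"] by (simp add: power_mult_distrib)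
  then have j: "j = j'" by (simp add: P_sq u_inj)
  show ?thesis
    using P M sg_cancel[OF P_nonzero[of j], of e e'] sg_cancel[OF M_nonzero[of j], of d d'] unfolding j by simp
qed

lemma card_roots: "card (complex_roots f) = 8"
proof -
  have "inj (\<lambda>(j, e, d). octic_root j e d)"
    unfolding inj_def split_paired_All prod.case prod.inject using root_inj by simp
  then have "card (complex_roots f) = card (UNIV :: (bool \<times> bool \<times> bool) set)"
    unfolding complex_roots_eq by (rule card_image)
  then show ?thesis by (simp flip: UNIV_Times_UNIV add: card_cartesian_product)
qed

lemma w_nonzero: "w \<noteq> 0"
  using M_nonzero by (simp add: w_def)

lemma P_other: "P (\<not> j) = of_rat s * inverse (w * P j)"
proof -
  have "of_rat s = P (\<not> j) * (w * P j)"
    by (cases j) (simp_all add: w_def flip: PM_prod)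
  moreover have "w * P j \<noteq> 0" using w_nonzero P_nonzero by simp
  ultimately show ?thesis by (metis mult.assoc right_inverse mult_1_right)
qed

lemma M_other: "M (\<not> j) = w * inverse (M j)"
proof -
  have "w = M (\<not> j) * M j" by (cases j) (simp_all add: w_def)
  then show ?thesis using M_nonzero[of j] by simp
qed

lemma w_sq: "w\<^sup>2 = of_rat (b + 2 + 2 * a)"
proof -
  have "w\<^sup>2 = (u False - 2) * (u True - 2)"
    by (simp add: w_def power_mult_distrib M_sq)
  also have "\<dots> = u False * u True - 2 * (u False + u True) + 4" by (simp add: algebra_simps)
  also have "\<dots> = of_rat (b + 2 + 2 * a)" unfolding u_sum u_prod by (simp add: of_rat_add of_rat_mult)
  finally show ?thesis .
qed

lemma \<delta>_sq: "\<delta>\<^sup>2 = of_rat (a\<^sup>2 - 4 * b + 8)"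
proof -
  have "\<delta>\<^sup>2 = (u False + u True)\<^sup>2 - 4 * (u False * u True)"
    by (simp add: \<delta>_def power2_eq_square algebra_simps)
  also have "\<dots> = of_rat (a\<^sup>2 - 4 * b + 8)" unfolding u_sum u_prod
    by (simp add: of_rat_add of_rat_mult of_rat_diff of_rat_power algebra_simps)
  finally show ?thesis .
qed

text \<open>The two values \<open>P False * M True \<plusminus> P True * M False\<close>; half of each is a square root of one of the
  numbers \<open>(b - 6 \<plusminus> s) / 2\<close>.\<close>

definition cross :: "bool \<Rightarrow> complex"
  where "cross c = P False * M True + sg c * (P True * M False)"

lemma cross_sq: "(cross c / 2)\<^sup>2 = of_rat ((b - 6 + (if c then - s else s)) / 2)"
proof -
  have "(cross c)\<^sup>2 = (P False)\<^sup>2 * (M True)\<^sup>2 + (P True)\<^sup>2 * (M False)\<^sup>2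
      + 2 * sg c * (P False * P True * M False * M True)"
    by (cases c) (simp_all add: cross_def power2_eq_square algebra_simps)
  also have "\<dots> = 2 * (u False * u True) - 8 + 2 * sg c * of_rat s"
    unfolding P_sq M_sq PM_prod by (simp add: algebra_simps)
  also have "\<dots> = 2 * of_rat b - 12 + 2 * sg c * of_rat s"
    unfolding u_prod by simp
  finally show ?thesis
    by (cases c) (simp_all add: power_divide of_rat_add of_rat_diff of_rat_divide of_rat_minus field_simps)
qed

lemma cross_nonzero: "cross c \<noteq> 0"
proof -
  have "cross False * cross True = (P False)\<^sup>2 * (M True)\<^sup>2 - (P True)\<^sup>2 * (M False)\<^sup>2"
    by (simp add: cross_def power2_eq_square algebra_simps)
  also have "\<dots> = - 4 * \<delta>" unfolding P_sq M_sq by (simp add: \<delta>_def algebra_simps)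
  finally show ?thesis using \<delta>_nonzero by (cases c) auto
qed

section \<open>The four bits of an automorphism\<close>

lemma root_in_K: "octic_root j e d \<in> K"
  using root_in_roots roots_subset_splitting_set by blast

lemma sg_in_K: "sg x \<in> K"
  unfolding sg_rat by blast

lemma P_in_K: "P j \<in> K"
  using root_plus_inverse[of j False False] root_in_K[of j False False]
    splitting_set_closed(2)[OF root_in_K splitting_set_closed(5)[OF root_in_K]]
  by (metis sg_simps(1) mult_1)

lemma M_in_K: "M j \<in> K"
proof -
  have "octic_root j False False + - inverse (octic_root j False False) \<in> K"
    by (intro splitting_set_closed root_in_K)
  then show ?thesis using root_minus_inverse[of j False False] by simp
qed

lemma u_eq: "u j = P j * P j + of_rat (- 2)"
  using P_sq[of j] by (simp add: power2_eq_square of_rat_minus)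

lemma u_in_K: "u j \<in> K"
  unfolding u_eq by (intro splitting_set_closed P_in_K)

lemma w_in_K: "w \<in> K"
  unfolding w_def by (intro splitting_set_closed M_in_K)

text \<open>The bits as read off from an arbitrary map. Their meaning for automorphisms is given by
  \<open>u_image\<close>, \<open>P_image\<close>, \<open>M_image\<close> and \<open>w_image\<close> below: a bit is set when the corresponding
  index or sign changes.\<close>

definition "j_bit \<sigma> \<longleftrightarrow> \<sigma> (u False) \<noteq> u False"
definition "e_bit \<sigma> \<longleftrightarrow> \<sigma> (P False) \<noteq> P (j_bit \<sigma>)"
definition "d_bit \<sigma> \<longleftrightarrow> \<sigma> (M False) \<noteq> M (j_bit \<sigma>)"
definition "h_bit \<sigma> \<longleftrightarrow> \<sigma> w \<noteq> w"

context
  fixes \<sigma> assumes \<sigma>: "\<sigma> \<in> G"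
begin

lemma \<sigma>_sg: "\<sigma> (sg x) = sg x"
  unfolding sg_rat by (rule galois_of_rat[OF \<sigma>])

lemma \<sigma>_sq: "x \<in> K \<Longrightarrow> \<sigma> (x\<^sup>2) = (\<sigma> x)\<^sup>2"
  by (simp add: power2_eq_square galois_mult[OF \<sigma>])

lemma u_image: "\<sigma> (u i) = u (i \<noteq> j_bit \<sigma>)"
proof -
  let ?v = "\<sigma> (u False)"
  have uT: "u True = - u False + of_rat (- a)" using u_sum by (simp add: of_rat_minus algebra_simps)
  have vT: "\<sigma> (u True) = - ?v + of_rat (- a)"
    unfolding uT by (simp only: galois_add[OF \<sigma>] galois_uminus[OF \<sigma>] galois_of_rat[OF \<sigma>] u_in_K splitting_set_closed)
  have "\<sigma> (u False * u True) = u False * u True"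
    unfolding u_prod using galois_of_rat[OF \<sigma>, of "b - 2"] by (simp add: of_rat_diff)
  then have "?v * \<sigma> (u True) = u False * u True"
    using galois_mult[OF \<sigma> u_in_K u_in_K] by simp
  then have "?v * (- ?v + of_rat (- a)) = u False * u True" by (simp only: vT)
  moreover have "(?v - u False) * (?v - u True) = u False * u True - ?v * (- ?v + of_rat (- a))"
  proof -
    have r: "of_rat (- a) = u False + u True" unfolding u_sum by (simp add: of_rat_minus)
    show ?thesis unfolding r by (simp add: algebra_simps)
  qed
  ultimately have "(?v - u False) * (?v - u True) = 0" by simp
  then have "?v = u (j_bit \<sigma>)" using u_inj[of True False] by (auto simp: j_bit_def)
  moreover from this have "\<sigma> (u True) = u (\<not> j_bit \<sigma>)"
    using vT uT by (cases "j_bit \<sigma>") auto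
  ultimately show ?thesis by (cases i) auto
qed

lemma w_image: "\<sigma> w = sg (h_bit \<sigma>) * w"
proof -
  have "(\<sigma> w)\<^sup>2 = w\<^sup>2"
    using \<sigma>_sq[OF w_in_K] galois_of_rat[OF \<sigma>] by (simp only: w_sq)
  then show ?thesis unfolding h_bit_def by (rule square_eq_sg)
qed

text \<open>The image of \<open>P False\<close> is a square root of \<open>u j + 2\<close>. The image of \<open>P True\<close> follows from it, since
  \<open>P True = s / (w * P False)\<close>; a change of sign of \<open>w\<close> therefore shows up in \<open>P True\<close>, and likewise
  in \<open>M True\<close> for the next lemma.\<close>

lemma P_image: "\<sigma> (P i) = sg (e_bit \<sigma> \<noteq> (i \<and> h_bit \<sigma>)) * P (i \<noteq> j_bit \<sigma>)"
proof -
  have "(\<sigma> (P False))\<^sup>2 = \<sigma> (u False + of_rat 2)"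
    using \<sigma>_sq[OF P_in_K, of False] by (simp add: P_sq)
  also have "\<dots> = (P (j_bit \<sigma>))\<^sup>2"
    using galois_add[OF \<sigma> u_in_K splitting_set_closed(6), of False 2] galois_of_rat[OF \<sigma>, of 2] u_image[of False]
    by (simp add: P_sq)
  finally have F: "\<sigma> (P False) = sg (e_bit \<sigma>) * P (j_bit \<sigma>)"
    unfolding e_bit_def by (rule square_eq_sg)
  have "\<sigma> (P True) = of_rat s * inverse (\<sigma> w * \<sigma> (P False))"
    using P_other[of False] P_in_K w_in_K
    by (simp add: galois_mult[OF \<sigma>] galois_inverse[OF \<sigma>] galois_of_rat[OF \<sigma>] splitting_set_closed)
  also have "\<dots> = sg (e_bit \<sigma> \<noteq> h_bit \<sigma>) * P (\<not> j_bit \<sigma>)"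
    unfolding F w_image P_other[of "j_bit \<sigma>"] by (simp add: sg_def)
  finally show ?thesis using F by (cases i) auto
qed

lemma M_image: "\<sigma> (M i) = sg (d_bit \<sigma> \<noteq> (i \<and> h_bit \<sigma>)) * M (i \<noteq> j_bit \<sigma>)"
proof -
  have "(\<sigma> (M False))\<^sup>2 = \<sigma> (u False + of_rat (- 2))"
    using \<sigma>_sq[OF M_in_K, of False] by (simp add: M_sq of_rat_minus)
  also have "\<dots> = (M (j_bit \<sigma>))\<^sup>2"
    using galois_add[OF \<sigma> u_in_K splitting_set_closed(6), of False "- 2"] galois_of_rat[OF \<sigma>, of "- 2"] u_image[of False]
    by (simp add: M_sq of_rat_minus)
  finally have F: "\<sigma> (M False) = sg (d_bit \<sigma>) * M (j_bit \<sigma>)"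
    unfolding d_bit_def by (rule square_eq_sg)
  have "\<sigma> (M True) = \<sigma> w * inverse (\<sigma> (M False))"
    using M_other[of False] M_in_K w_in_K
    by (simp add: galois_mult[OF \<sigma>] galois_inverse[OF \<sigma>] splitting_set_closed)
  also have "\<dots> = sg (d_bit \<sigma> \<noteq> h_bit \<sigma>) * M (\<not> j_bit \<sigma>)"
    unfolding F w_image M_other[of "j_bit \<sigma>"] by (simp add: sg_def)
  finally show ?thesis using F by (cases i) auto
qed

lemma root_image:
  "\<sigma> (octic_root i e d) = octic_root (i \<noteq> j_bit \<sigma>) (e \<noteq> (e_bit \<sigma> \<noteq> (i \<and> h_bit \<sigma>))) (d \<noteq> (d_bit \<sigma> \<noteq> (i \<and> h_bit \<sigma>)))"
proof -
  have r: "octic_root i e d = (sg e * P i + sg d * M i) * of_rat (1 / 2)" for i e d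
    by (simp add: octic_root_def of_rat_divide)
  have "\<sigma> (octic_root i e d) = (sg e * \<sigma> (P i) + sg d * \<sigma> (M i)) * of_rat (1 / 2)"
    unfolding r using P_in_K M_in_K sg_in_K
    by (simp add: galois_mult[OF \<sigma>] galois_add[OF \<sigma>] \<sigma>_sg galois_of_rat[OF \<sigma>] splitting_set_closed
        del: of_rat_divide)
  also have "\<dots> = (sg e * sg (e_bit \<sigma> \<noteq> (i \<and> h_bit \<sigma>)) * P (i \<noteq> j_bit \<sigma>) +
      sg d * sg (d_bit \<sigma> \<noteq> (i \<and> h_bit \<sigma>)) * M (i \<noteq> j_bit \<sigma>)) * of_rat (1 / 2)"
    unfolding P_image M_image by (simp only: mult.assoc)
  finally show ?thesis unfolding r sg_mult .
qed

lemma bits_eqI: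
  assumes "\<sigma> (octic_root False False False) = octic_root j e d"
  shows "j_bit \<sigma> = j \<and> e_bit \<sigma> = e \<and> d_bit \<sigma> = d"
  using assms root_image[of False False False] root_inj by auto

lemma h_bit_eqI: "\<sigma> w = sg h * w \<Longrightarrow> h_bit \<sigma> = h"
  using w_nonzero by (auto simp: h_bit_def sg_def)

lemma cross_image: "\<sigma> (cross c) = sg (e_bit \<sigma> \<noteq> (d_bit \<sigma> \<noteq> (h_bit \<sigma> \<noteq> (c \<and> j_bit \<sigma>)))) * cross c"
proof -
  have "\<sigma> (cross c) = \<sigma> (P False) * \<sigma> (M True) + sg c * (\<sigma> (P True) * \<sigma> (M False))"
    unfolding cross_def using P_in_K M_in_K sg_in_K
    by (simp add: galois_mult[OF \<sigma>] galois_add[OF \<sigma>] \<sigma>_sg splitting_set_closed)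
  then show ?thesis unfolding P_image M_image cross_def
    by (cases "j_bit \<sigma>"; cases "e_bit \<sigma>"; cases "d_bit \<sigma>"; cases "h_bit \<sigma>"; cases c) simp_all
qed

lemma \<delta>w_image: "\<sigma> (\<delta> * w) = sg (j_bit \<sigma> \<noteq> h_bit \<sigma>) * (\<delta> * w)"
proof -
  have "\<sigma> (u False + - u True) = \<sigma> (u False) + - \<sigma> (u True)"
    using u_in_K by (simp only: galois_add[OF \<sigma>] galois_uminus[OF \<sigma>] splitting_set_closed)
  then have "\<sigma> \<delta> = sg (j_bit \<sigma>) * \<delta>"
    unfolding u_image by (cases "j_bit \<sigma>") (simp_all add: \<delta>_def)
  moreover have "\<delta> \<in> K"
    using splitting_set_closed(2)[OF u_in_K splitting_set_closed(4)[OF u_in_K], of False True] by (simp add: \<delta>_def)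
  ultimately show ?thesis
    using galois_mult[OF \<sigma> _ w_in_K] w_image by (simp add: sg_def)
qed

end

lemma galois_bits_inj:
  assumes "\<sigma> \<in> G" "\<tau> \<in> G" "j_bit \<sigma> = j_bit \<tau>" "e_bit \<sigma> = e_bit \<tau>" "d_bit \<sigma> = d_bit \<tau>" "h_bit \<sigma> = h_bit \<tau>"
  shows "\<sigma> = \<tau>"
  using assms by (intro galois_eqI[OF assms(1,2)]) (auto elim!: rootE simp: root_image)

text \<open>The correction term \<open>j_bit \<tau> \<and> h_bit \<sigma>\<close> arises when \<open>\<tau>\<close> moves \<open>P False\<close> to \<open>\<plusminus> P True\<close>, on which
  \<open>\<sigma>\<close> acts with the additional sign \<open>\<sigma> w / w\<close>. It is the same term for \<open>e\<close> and \<open>d\<close>.\<close>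

lemma
  assumes st: "\<sigma> \<in> G" "\<tau> \<in> G"
  shows galois_comp_closed: "\<sigma> \<otimes>\<^bsub>galois_group f\<^esub> \<tau> \<in> G"
    and j_bit_comp: "j_bit (\<sigma> \<otimes>\<^bsub>galois_group f\<^esub> \<tau>) = (j_bit \<sigma> \<noteq> j_bit \<tau>)"
    and e_bit_comp: "e_bit (\<sigma> \<otimes>\<^bsub>galois_group f\<^esub> \<tau>) = (e_bit \<sigma> \<noteq> (e_bit \<tau> \<noteq> (j_bit \<tau> \<and> h_bit \<sigma>)))"
    and d_bit_comp: "d_bit (\<sigma> \<otimes>\<^bsub>galois_group f\<^esub> \<tau>) = (d_bit \<sigma> \<noteq> (d_bit \<tau> \<noteq> (j_bit \<tau> \<and> h_bit \<sigma>)))"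
    and h_bit_comp: "h_bit (\<sigma> \<otimes>\<^bsub>galois_group f\<^esub> \<tau>) = (h_bit \<sigma> \<noteq> h_bit \<tau>)"
proof -
  let ?\<rho> = "\<sigma> \<otimes>\<^bsub>galois_group f\<^esub> \<tau>"
  show \<rho>: "?\<rho> \<in> G"
    using st group.is_monoid[OF galois_group_group] by (meson monoid.m_closed)
  have app: "?\<rho> x = \<sigma> (\<tau> x)" if "x \<in> K" for x
    using that by (simp add: galois_comp[OF st] compose_def)
  have "?\<rho> (octic_root False False False) = octic_root (j_bit \<sigma> \<noteq> j_bit \<tau>)
      (e_bit \<sigma> \<noteq> (e_bit \<tau> \<noteq> (j_bit \<tau> \<and> h_bit \<sigma>))) (d_bit \<sigma> \<noteq> (d_bit \<tau> \<noteq> (j_bit \<tau> \<and> h_bit \<sigma>)))"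
    unfolding app[OF root_in_K] root_image[OF st(2)] root_image[OF st(1)]
    by (intro arg_cong3[where f = octic_root]) auto
  from bits_eqI[OF \<rho> this] show "j_bit ?\<rho> = (j_bit \<sigma> \<noteq> j_bit \<tau>)"
    "e_bit ?\<rho> = (e_bit \<sigma> \<noteq> (e_bit \<tau> \<noteq> (j_bit \<tau> \<and> h_bit \<sigma>)))"
    "d_bit ?\<rho> = (d_bit \<sigma> \<noteq> (d_bit \<tau> \<noteq> (j_bit \<tau> \<and> h_bit \<sigma>)))" by blast+
  have "?\<rho> w = sg (h_bit \<sigma> \<noteq> h_bit \<tau>) * w"
    unfolding app[OF w_in_K] w_image[OF st(2)]
    by (simp add: galois_mult[OF st(1) sg_in_K w_in_K] \<sigma>_sg[OF st(1)] w_image[OF st(1)]) (simp add: sg_def)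
  then show "h_bit ?\<rho> = (h_bit \<sigma> \<noteq> h_bit \<tau>)" by (rule h_bit_eqI[OF \<rho>])
qed

section \<open>Which bits occur\<close>

text \<open>The field generated by one root. It contains \<open>P False\<close>, \<open>M False\<close> and \<open>\<delta>\<close>, while \<open>P True\<close> and
  \<open>M True\<close> lie in \<open>L * w\<close>; so the splitting field is \<open>L + L * w\<close>, and everything depends on
  whether \<open>w \<in> L\<close>.\<close>

abbreviation "L \<equiv> range (\<lambda>g. qeval g (octic_root False False False))"

lemma L_subfield: "subfield L ring_of_type_algebra"
  using subfield_simple_extension[OF irr] root_in_roots by (simp add: complex_roots_def)

lemmas L_closed = subfield_complex_1[OF L_subfield] subfield_complex_add[OF L_subfield]
  subfield_complex_mult[OF L_subfield] subfield_complex_uminus[OF L_subfield]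
  subfield_complex_inverse[OF L_subfield] subfield_complex_rat[OF L_subfield]

lemma root_in_L: "octic_root False False False \<in> L"
  by (rule range_eqI[of _ _ "[:0, 1:]"]) simp

lemma P_in_L: "P False \<in> L"
  using root_plus_inverse[of False False False]
    L_closed(2)[OF root_in_L L_closed(5)[OF root_in_L]] by simp

lemma M_in_L: "M False \<in> L"
  using root_minus_inverse[of False False False]
    L_closed(2)[OF root_in_L L_closed(4)[OF L_closed(5)[OF root_in_L]]] by simp

lemma \<delta>_in_L: "\<delta> \<in> L"
proof -
  have "\<delta> = of_rat 2 * u False + of_rat a"
    using u_sum by (simp add: \<delta>_def algebra_simps eq_neg_iff_add_eq_0)
  also have "\<dots> \<in> L"
    unfolding u_eq by (intro L_closed P_in_L)
  finally show ?thesis .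
qed

lemma P_True_in_Lw: "\<exists>y\<in>L. P True = y * w"
proof
  show "P True = of_rat s * inverse (of_rat (b + 2 + 2 * a) * P False) * w"
    unfolding w_sq[symmetric] using P_other[of False] w_nonzero
    by (simp add: power2_eq_square field_simps)
qed (intro L_closed P_in_L)

lemma M_True_in_Lw: "\<exists>y\<in>L. M True = y * w"
proof
  show "M True = inverse (M False) * w"
    using M_other[of False] by simp
qed (intro L_closed M_in_L)

lemma root_in_L_plus_Lw: "\<exists>x\<in>L. \<exists>y\<in>L. octic_root j e d = x + y * w"
proof -
  have sgL: "sg x \<in> L" for x unfolding sg_rat by (rule L_closed)
  show ?thesis
  proof (cases j)
    case False
    have "octic_root j e d = (sg e * P False + sg d * M False) * of_rat (1 / 2) + of_rat 0 * w"
      using False by (simp add: octic_root_def of_rat_divide)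
    moreover have "(sg e * P False + sg d * M False) * of_rat (1 / 2) \<in> L"
      by (intro L_closed sgL P_in_L M_in_L)
    ultimately show ?thesis using L_closed(6)[of 0] by blast
  next
    case True
    obtain x y where xy: "x \<in> L" "P True = x * w" "y \<in> L" "M True = y * w"
      using P_True_in_Lw M_True_in_Lw by blast
    have "octic_root j e d = of_rat 0 + ((sg e * x + sg d * y) * of_rat (1 / 2)) * w"
      using True by (simp add: octic_root_def of_rat_divide xy(2,4) algebra_simps)
    moreover have "(sg e * x + sg d * y) * of_rat (1 / 2) \<in> L"
      by (intro L_closed sgL xy)
    ultimately show ?thesis using L_closed(6)[of 0] by blast
  qed
qed

lemma exists_bits:
  assumes w: "w \<in> L"
  shows "\<exists>\<sigma>\<in>G. j_bit \<sigma> = j \<and> e_bit \<sigma> = e \<and> d_bit \<sigma> = d"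
proof -
  have "complex_roots f \<subseteq> L"
  proof
    fix x assume "x \<in> complex_roots f"
    then obtain j e d where "x = octic_root j e d" by (rule rootE)
    then obtain y z where yz: "y \<in> L" "z \<in> L" "x = y + z * w"
      using root_in_L_plus_Lw[of j e d] by blast
    show "x \<in> L" unfolding yz(3) by (intro L_closed(2,3) yz w)
  qed
  from galois_transitive_simple[OF irr root_in_roots root_in_roots[of j e d] this]
  obtain \<sigma> where "\<sigma> \<in> G" "\<sigma> (octic_root False False False) = octic_root j e d" by blast
  then show ?thesis using bits_eqI[of \<sigma> j e d] by blast
qed

lemma exists_all_bits:
  assumes w: "w \<notin> L"
  shows "\<exists>\<sigma>\<in>G. j_bit \<sigma> = j \<and> e_bit \<sigma> = e \<and> d_bit \<sigma> = d \<and> h_bit \<sigma> = h"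
proof -
  have "\<exists>g h. x = qeval g (octic_root False False False) + qeval h (octic_root False False False) * w"
    if "x \<in> complex_roots f" for x
    using that root_in_L_plus_Lw by (elim rootE) blast
  from galois_transitive_quadratic[OF irr root_in_roots root_in_roots[of j e d] w_sq w w_in_K this
      sg_simps(5)[of h]]
  obtain \<sigma> where \<sigma>: "\<sigma> \<in> G" "\<sigma> (octic_root False False False) = octic_root j e d" "\<sigma> w = sg h * w"
    by blast
  show ?thesis using bits_eqI[OF \<sigma>(1,2)] h_bit_eqI[OF \<sigma>(1,3)] \<sigma>(1) by blast
qed

lemma orbit:
  assumes "y \<in> complex_roots f"
  shows "\<exists>\<sigma>\<in>G. \<sigma> (octic_root False False False) = y"
proof -
  obtain j e d where y: "y = octic_root j e d" using assms by (rule rootE)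
  obtain \<sigma> where "\<sigma> \<in> G" "j_bit \<sigma> = j" "e_bit \<sigma> = e" "d_bit \<sigma> = d"
    using exists_bits[of j e d] exists_all_bits[of j e d False] by blast
  then have "\<sigma> (octic_root False False False) = y"
    using root_image[of \<sigma> False False False] y by simp
  then show ?thesis using \<open>\<sigma> \<in> G\<close> by blast
qed

lemma fixed_rational:
  assumes "x \<in> L" "\<And>\<sigma>. \<sigma> \<in> G \<Longrightarrow> \<sigma> x = x"
  shows "x \<in> \<rat>"
proof -
  obtain g where g: "x = qeval g (octic_root False False False)" using assms(1) by blast
  show ?thesis
  proof (rule fixed_imp_rational[OF g root_in_roots])
    show "f \<noteq> 0" "degree f \<le> card (complex_roots f)" by (simp_all add: card_roots)
  qed (use orbit assms(2) in blast)+
qed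

lemma rational_in_L: "x \<in> \<rat> \<Longrightarrow> x \<in> L"
  by (auto elim!: Rats_cases intro: L_closed)

lemma rational_fixed: "x \<in> \<rat> \<Longrightarrow> \<sigma> \<in> G \<Longrightarrow> \<sigma> x = x"
  by (auto elim!: Rats_cases simp: galois_of_rat)

text \<open>If \<open>w \<in> L\<close>, an automorphism is determined by the image of one root, hence by its first three bits,
  and \<open>h\<close> is a function \<open>H\<close> of these. Each of the possible functions identifies an element of \<open>L\<close>
  that every automorphism fixes and that is therefore rational. Conversely, \<open>\<delta> * w\<close> and \<open>cross c\<close> are
  nonzero multiples of \<open>w\<close> by elements of \<open>L\<close>.\<close>

lemma w_in_L_iff: "w \<in> L \<longleftrightarrow> w \<in> \<rat> \<or> \<delta> * w \<in> \<rat> \<or> (\<exists>c. cross c \<in> \<rat>)"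
proof
  assume w: "w \<in> L"
  obtain gw where gw: "w = qeval gw (octic_root False False False)" using w by blast
  have det: "h_bit \<sigma> = h_bit \<tau>"
    if "\<sigma> \<in> G" "\<tau> \<in> G" "j_bit \<sigma> = j_bit \<tau>" "e_bit \<sigma> = e_bit \<tau>" "d_bit \<sigma> = d_bit \<tau>" for \<sigma> \<tau>
  proof -
    have "\<sigma> (octic_root False False False) = \<tau> (octic_root False False False)"
      using that by (simp add: root_image)
    then have "\<sigma> w = \<tau> w"
      unfolding gw using galois_qeval[OF that(1) root_in_K] galois_qeval[OF that(2) root_in_K] by metis
    then show ?thesis by (simp add: h_bit_def)
  qed
  define H where "H j e d \<longleftrightarrow> (\<exists>\<sigma>\<in>G. j_bit \<sigma> = j \<and> e_bit \<sigma> = e \<and> d_bit \<sigma> = d \<and> h_bit \<sigma>)" for j e d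
  have H: "H (j_bit \<sigma>) (e_bit \<sigma>) (d_bit \<sigma>) = h_bit \<sigma>" if "\<sigma> \<in> G" for \<sigma>
    unfolding H_def using that det by blast
  have "H (j \<noteq> j') (e \<noteq> (e' \<noteq> (j' \<and> H j e d))) (d \<noteq> (d' \<noteq> (j' \<and> H j e d)))
     = (H j e d \<noteq> H j' e' d')" for j e d j' e' d'
  proof -
    obtain \<sigma> \<tau> where st: "\<sigma> \<in> G" "j_bit \<sigma> = j" "e_bit \<sigma> = e" "d_bit \<sigma> = d"
      "\<tau> \<in> G" "j_bit \<tau> = j'" "e_bit \<tau> = e'" "d_bit \<tau> = d'"
      using exists_bits[OF w] by metis
    show ?thesis
      using H[OF galois_comp_closed[OF st(1,5)]] H[OF st(1)] H[OF st(5)]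
      unfolding j_bit_comp[OF st(1,5)] e_bit_comp[OF st(1,5)] d_bit_comp[OF st(1,5)]
        h_bit_comp[OF st(1,5)] st by simp
  qed
  then obtain \<alpha> \<gamma> where "\<forall>j e d. H j e d = ((\<alpha> \<and> e \<noteq> d) \<noteq> (\<gamma> \<and> j))"
    using twisted_additive_bool[of H] by blast
  then have h: "h_bit \<sigma> = ((\<alpha> \<and> e_bit \<sigma> \<noteq> d_bit \<sigma>) \<noteq> (\<gamma> \<and> j_bit \<sigma>))" if "\<sigma> \<in> G" for \<sigma>
    using H[OF that] by simp
  have crossL: "cross c \<in> L" for c
  proof -
    obtain x y where xy: "x \<in> L" "P True = x * w" "y \<in> L" "M True = y * w"
      using P_True_in_Lw M_True_in_Lw by blast
    show ?thesis unfolding cross_def xy(2,4) sg_rat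
      by (intro L_closed P_in_L M_in_L w xy)
  qed
  show "w \<in> \<rat> \<or> \<delta> * w \<in> \<rat> \<or> (\<exists>c. cross c \<in> \<rat>)"
  proof (cases \<alpha>)
    case True
    have "cross \<gamma> \<in> \<rat>"
    proof (rule fixed_rational[OF crossL])
      fix \<sigma> assume \<sigma>: "\<sigma> \<in> G"
      have "(e_bit \<sigma> \<noteq> (d_bit \<sigma> \<noteq> (h_bit \<sigma> \<noteq> (\<gamma> \<and> j_bit \<sigma>)))) = False"
        unfolding h[OF \<sigma>] using True by blast
      then show "\<sigma> (cross \<gamma>) = cross \<gamma>"
        unfolding cross_image[OF \<sigma>] by (simp only: sg_simps mult_1)
    qed
    then show ?thesis by blast
  next
    case \<alpha>: False
    show ?thesis
    proof (cases \<gamma>)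
      case True
      have "\<delta> * w \<in> \<rat>"
        by (rule fixed_rational[OF L_closed(3)[OF \<delta>_in_L w]]) (simp add: \<delta>w_image h \<alpha> True)
      then show ?thesis by blast
    next
      case False
      have "w \<in> \<rat>"
        by (rule fixed_rational[OF w]) (simp add: w_image h \<alpha> False)
      then show ?thesis by blast
    qed
  qed
next
  assume "w \<in> \<rat> \<or> \<delta> * w \<in> \<rat> \<or> (\<exists>c. cross c \<in> \<rat>)"
  then show "w \<in> L"
  proof (elim disjE exE)
    assume "\<delta> * w \<in> \<rat>"
    then have "inverse \<delta> * (\<delta> * w) \<in> L"
      by (intro L_closed \<delta>_in_L rational_in_L)
    moreover have "inverse \<delta> * (\<delta> * w) = w" using \<delta>_nonzero by simp
    ultimately show ?thesis by simp
  next
    fix c assume cr: "cross c \<in> \<rat>"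
    obtain x y where xy: "x \<in> L" "P True = x * w" "y \<in> L" "M True = y * w"
      using P_True_in_Lw M_True_in_Lw by blast
    let ?k = "P False * y + sg c * (x * M False)"
    have "cross c = w * ?k" by (simp add: cross_def xy(2,4) algebra_simps)
    then have "?k \<noteq> 0" "w = cross c * inverse ?k" using cross_nonzero[of c] by auto
    moreover have "cross c * inverse ?k \<in> L"
      unfolding sg_rat by (intro L_closed rational_in_L[OF cr] P_in_L M_in_L xy)
    ultimately show ?thesis by simp
  qed (rule rational_in_L)
qed

end

section \<open>The four groups\<close>

lemma is_iso_explicitI:
  assumes "\<And>x. x \<in> carrier A \<Longrightarrow> \<kappa> x \<in> carrier B"
    and "\<And>x y. x \<in> carrier A \<Longrightarrow> y \<in> carrier A \<Longrightarrow> \<kappa> (x \<otimes>\<^bsub>A\<^esub> y) = \<kappa> x \<otimes>\<^bsub>B\<^esub> \<kappa> y"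
    and "\<And>x y. x \<in> carrier A \<Longrightarrow> y \<in> carrier A \<Longrightarrow> \<kappa> x = \<kappa> y \<Longrightarrow> x = y"
    and "\<And>z. z \<in> carrier B \<Longrightarrow> \<exists>x\<in>carrier A. \<kappa> x = z"
  shows "A \<cong> B"
proof (rule is_isoI)
  have "\<kappa> ` carrier A = carrier B"
    using assms(1,4) by (fastforce simp: image_iff)
  then show "\<kappa> \<in> iso A B"
    unfolding iso_def hom_def bij_betw_def inj_on_def using assms(1,2,3) by simp
qed

text \<open>The bits \<open>j\<close> and \<open>e\<close> as the two binary digits of a residue modulo 4. The correction term in the
  composition law of \<open>e\<close> is a carry when \<open>h = j\<close>; in general it is the carry or borrow of the
  dihedral multiplication, where \<open>j \<noteq> h\<close> marks the reflections.\<close>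

definition quarter_turns :: "bool \<Rightarrow> bool \<Rightarrow> int"
  where "quarter_turns j e = of_bool j + 2 * of_bool e"

lemma quarter_turns_range: "quarter_turns j e \<in> {0..<4}"
  by (cases j; cases e) (simp_all add: quarter_turns_def)

lemma quarter_turns_eq_iff [simp]: "quarter_turns j e = quarter_turns j' e' \<longleftrightarrow> j = j' \<and> e = e'"
  by (cases j; cases e; cases j'; cases e') (simp_all add: quarter_turns_def)

lemma quarter_turnsE:
  assumes "i \<in> {0..<4}"
  obtains j e where "i = quarter_turns j e"
proof -
  have "i = 0 \<or> i = 1 \<or> i = 2 \<or> i = 3" using assms by auto
  then have "i = quarter_turns (odd i) (i \<ge> 2)" by (auto simp: quarter_turns_def)
  then show ?thesis by (rule that)
qed

lemma quarter_turns_dihedral: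
  "quarter_turns (j \<noteq> j') (e \<noteq> (e' \<noteq> (j' \<and> h))) =
    (if j \<noteq> h then quarter_turns j e - quarter_turns j' e' else quarter_turns j e + quarter_turns j' e') mod 4"
  by (cases j; cases e; cases j'; cases e'; cases h) (simp_all add: quarter_turns_def)

lemma quarter_turns_cyclic:
  "quarter_turns (j \<noteq> j') (e \<noteq> (e' \<noteq> (j' \<and> j))) = (quarter_turns j e + quarter_turns j' e') mod 4"
  by (cases j; cases e; cases j'; cases e') (simp_all add: quarter_turns_def)

lemma of_bool_xor: "of_bool (x \<noteq> y) = (of_bool x + of_bool y :: int) mod 2"
  by (cases x; cases y) simp_all

lemma bitE:
  assumes "i \<in> {0..<2 :: int}"
  obtains x where "i = of_bool x"
proof -
  have "i = of_bool (i = 1)" using assms by auto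
  then show ?thesis by (rule that)
qed

context reciprocal_octic
begin

lemma sg_fixed: "y \<noteq> 0 \<Longrightarrow> sg x * y = y \<Longrightarrow> \<not> x"
  by (auto simp: sg_def)

lemma h_bit_if_w_rational:
  assumes "w \<in> \<rat>" "\<sigma> \<in> G"
  shows "h_bit \<sigma> = False"
  using rational_fixed[OF assms] by (simp add: h_bit_def)

lemma h_bit_if_\<delta>w_rational:
  assumes "\<delta> * w \<in> \<rat>" "\<sigma> \<in> G"
  shows "h_bit \<sigma> = j_bit \<sigma>"
  using sg_fixed[of "\<delta> * w" "j_bit \<sigma> \<noteq> h_bit \<sigma>"] rational_fixed[OF assms] \<delta>w_image[OF assms(2)]
    \<delta>_nonzero w_nonzero by simp

lemma h_bit_if_cross_rational:
  assumes "cross c \<in> \<rat>" "\<sigma> \<in> G"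
  shows "h_bit \<sigma> = (e_bit \<sigma> \<noteq> (d_bit \<sigma> \<noteq> (c \<and> j_bit \<sigma>)))"
proof -
  have "\<not> (e_bit \<sigma> \<noteq> (d_bit \<sigma> \<noteq> (h_bit \<sigma> \<noteq> (c \<and> j_bit \<sigma>))))"
    by (rule sg_fixed[OF cross_nonzero[of c]])
      (simp only: cross_image[OF assms(2), symmetric] rational_fixed[OF assms])
  then show ?thesis by blast
qed

lemma in_classI:
  assumes "galois_group f \<cong> T"
  shows "galois_group_in_class f 8 (transitive_subgroups_iso 8 T)"
  by (rule galois_group_in_class_iso[OF card_roots _ root_in_roots orbit assms]) simp

text \<open>With \<open>h = 0\<close> the composition law has no correction term, so the other three bits simply add.\<close>

lemma galois_group_C2_C2_C2:
  assumes w: "w \<in> \<rat>"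
  shows "galois_group f \<cong> integer_mod_group 2 \<times>\<times> integer_mod_group 2 \<times>\<times> integer_mod_group 2"
    (is "_ \<cong> ?T")
proof (rule is_iso_explicitI)
  let ?k = "\<lambda>\<sigma>. (of_bool (j_bit \<sigma>) :: int, of_bool (e_bit \<sigma>) :: int, of_bool (d_bit \<sigma>) :: int)"
  note h = h_bit_if_w_rational[OF w]
  show "?k \<sigma> \<in> carrier ?T" for \<sigma>
    by (simp add: carrier_integer_mod_group)
  fix \<sigma> \<tau> assume st: "\<sigma> \<in> G" "\<tau> \<in> G"
  show "?k (\<sigma> \<otimes>\<^bsub>galois_group f\<^esub> \<tau>) = ?k \<sigma> \<otimes>\<^bsub>?T\<^esub> ?k \<tau>"
    by (simp only: j_bit_comp[OF st] e_bit_comp[OF st] d_bit_comp[OF st] h[OF st(1)]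
        mult_DirProd mult_integer_mod_group of_bool_xor simp_thms) simp
  show "\<sigma> = \<tau>" if "?k \<sigma> = ?k \<tau>"
    by (rule galois_bits_inj[OF st]) (use that h[OF st(1)] h[OF st(2)] in auto)
next
  fix z assume "z \<in> carrier ?T"
  then obtain x y t where z: "z = (x, y, t)" "x \<in> {0..<2}" "y \<in> {0..<2}" "t \<in> {0..<2}"
    by (auto simp: carrier_integer_mod_group)
  obtain j e d where "x = of_bool j" "y = of_bool e" "t = of_bool d"
    using z(2,3,4) by (metis bitE)
  then show "\<exists>\<sigma>\<in>G. (of_bool (j_bit \<sigma>), of_bool (e_bit \<sigma>), of_bool (d_bit \<sigma>)) = z"
    using exists_bits[OF rational_in_L[OF w], of j e d] z(1) by auto
qed

text \<open>With \<open>h = j\<close> the correction term of \<open>e\<close> is the carry of an addition modulo 4. In \<open>e + d\<close> the two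
  equal correction terms cancel, which makes it a homomorphism to \<open>C\<^sub>2\<close>.\<close>

lemma galois_group_C4_C2:
  assumes \<delta>w: "\<delta> * w \<in> \<rat>"
  shows "galois_group f \<cong> integer_mod_group 4 \<times>\<times> integer_mod_group 2" (is "_ \<cong> ?T")
proof (rule is_iso_explicitI)
  let ?k = "\<lambda>\<sigma>. (quarter_turns (j_bit \<sigma>) (e_bit \<sigma>), of_bool (e_bit \<sigma> \<noteq> d_bit \<sigma>) :: int)"
  note h = h_bit_if_\<delta>w_rational[OF \<delta>w]
  show "?k \<sigma> \<in> carrier ?T" for \<sigma>
    using quarter_turns_range[of "j_bit \<sigma>" "e_bit \<sigma>"] by (simp add: carrier_integer_mod_group)
  fix \<sigma> \<tau> assume st: "\<sigma> \<in> G" "\<tau> \<in> G"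
  have "((e_bit \<sigma> \<noteq> (e_bit \<tau> \<noteq> (j_bit \<tau> \<and> j_bit \<sigma>))) \<noteq> (d_bit \<sigma> \<noteq> (d_bit \<tau> \<noteq> (j_bit \<tau> \<and> j_bit \<sigma>))))
      = ((e_bit \<sigma> \<noteq> d_bit \<sigma>) \<noteq> (e_bit \<tau> \<noteq> d_bit \<tau>))" by blast
  then show "?k (\<sigma> \<otimes>\<^bsub>galois_group f\<^esub> \<tau>) = ?k \<sigma> \<otimes>\<^bsub>?T\<^esub> ?k \<tau>"
    by (simp only: j_bit_comp[OF st] e_bit_comp[OF st] d_bit_comp[OF st] h[OF st(1)]
        mult_DirProd mult_integer_mod_group quarter_turns_cyclic of_bool_xor[of "_ \<noteq> _" "_ \<noteq> _"]) simp
  show "\<sigma> = \<tau>" if "?k \<sigma> = ?k \<tau>"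
    by (rule galois_bits_inj[OF st]) (use that h[OF st(1)] h[OF st(2)] in auto)
next
  fix z assume "z \<in> carrier ?T"
  then obtain x y where z: "z = (x, y)" "x \<in> {0..<4}" "y \<in> {0..<2}"
    by (auto simp: carrier_integer_mod_group)
  obtain j e where je: "x = quarter_turns j e" using z(2) by (rule quarter_turnsE)
  obtain t where t: "y = of_bool t" using z(3) by (rule bitE)
  have "w \<in> L" using w_in_L_iff \<delta>w by blast
  then obtain \<sigma> where "\<sigma> \<in> G" "j_bit \<sigma> = j" "e_bit \<sigma> = e" "d_bit \<sigma> = (e \<noteq> t)"
    using exists_bits[of j e "e \<noteq> t"] by blast
  then show "\<exists>\<sigma>\<in>G. (quarter_turns (j_bit \<sigma>) (e_bit \<sigma>), of_bool (e_bit \<sigma> \<noteq> d_bit \<sigma>)) = z"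
    using z(1) je t by (intro bexI[of _ \<sigma>]) auto
qed

text \<open>The bits \<open>j\<close>, \<open>e\<close>, \<open>h\<close> multiply like \<open>D\<^sub>4\<close>, and rationality of \<open>cross c\<close> expresses \<open>d\<close> by them.\<close>

lemma galois_group_D4:
  assumes cr: "cross c \<in> \<rat>"
  shows "galois_group f \<cong> dihedral_group 4" (is "_ \<cong> ?T")
proof (rule is_iso_explicitI)
  let ?k = "\<lambda>\<sigma>. (quarter_turns (j_bit \<sigma>) (e_bit \<sigma>), j_bit \<sigma> \<noteq> h_bit \<sigma>)"
  note h = h_bit_if_cross_rational[OF cr]
  show "?k \<sigma> \<in> carrier ?T" for \<sigma>
    using quarter_turns_range[of "j_bit \<sigma>" "e_bit \<sigma>"] by (simp add: dihedral_group_def)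
  fix \<sigma> \<tau> assume st: "\<sigma> \<in> G" "\<tau> \<in> G"
  show "?k (\<sigma> \<otimes>\<^bsub>galois_group f\<^esub> \<tau>) = ?k \<sigma> \<otimes>\<^bsub>?T\<^esub> ?k \<tau>"
    unfolding j_bit_comp[OF st] e_bit_comp[OF st] h_bit_comp[OF st] quarter_turns_dihedral
    by (auto simp: dihedral_group_def)
  show "\<sigma> = \<tau>" if "?k \<sigma> = ?k \<tau>"
    by (rule galois_bits_inj[OF st]) (use that h[OF st(1)] h[OF st(2)] in auto)
next
  fix z assume "z \<in> carrier ?T"
  then obtain x t where z: "z = (x, t)" "x \<in> {0..<4}"
    by (auto simp: dihedral_group_def)
  obtain j e where je: "x = quarter_turns j e" using z(2) by (rule quarter_turnsE)
  define d where "d = (e \<noteq> ((j \<noteq> t) \<noteq> (c \<and> j)))"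
  have "w \<in> L" using w_in_L_iff cr by blast
  then obtain \<sigma> where \<sigma>: "\<sigma> \<in> G" "j_bit \<sigma> = j" "e_bit \<sigma> = e" "d_bit \<sigma> = d"
    using exists_bits[of j e d] by blast
  then have "(j_bit \<sigma> \<noteq> h_bit \<sigma>) = t" using h_bit_if_cross_rational[OF cr \<sigma>(1)] d_def by auto
  then show "\<exists>\<sigma>\<in>G. (quarter_turns (j_bit \<sigma>) (e_bit \<sigma>), j_bit \<sigma> \<noteq> h_bit \<sigma>) = z"
    using z(1) je \<sigma> by (intro bexI[of _ \<sigma>]) auto
qed

text \<open>All four bits are free: \<open>j\<close>, \<open>e\<close>, \<open>h\<close> give \<open>D\<^sub>4\<close>, and \<open>e + d\<close>, in which the correction terms cancel,
  gives the factor \<open>C\<^sub>2\<close>.\<close>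

lemma galois_group_C2_D4:
  assumes w: "w \<notin> L"
  shows "galois_group f \<cong> integer_mod_group 2 \<times>\<times> dihedral_group 4" (is "_ \<cong> ?T")
proof (rule is_iso_explicitI)
  let ?k = "\<lambda>\<sigma>. (of_bool (e_bit \<sigma> \<noteq> d_bit \<sigma>) :: int,
    (quarter_turns (j_bit \<sigma>) (e_bit \<sigma>), j_bit \<sigma> \<noteq> h_bit \<sigma>))"
  show "?k \<sigma> \<in> carrier ?T" for \<sigma>
    using quarter_turns_range[of "j_bit \<sigma>" "e_bit \<sigma>"]
    by (simp add: dihedral_group_def carrier_integer_mod_group)
  fix \<sigma> \<tau> assume st: "\<sigma> \<in> G" "\<tau> \<in> G"
  have ed: "((e_bit \<sigma> \<noteq> (e_bit \<tau> \<noteq> (j_bit \<tau> \<and> h_bit \<sigma>))) \<noteq> (d_bit \<sigma> \<noteq> (d_bit \<tau> \<noteq> (j_bit \<tau> \<and> h_bit \<sigma>))))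
      = ((e_bit \<sigma> \<noteq> d_bit \<sigma>) \<noteq> (e_bit \<tau> \<noteq> d_bit \<tau>))" by blast
  show "?k (\<sigma> \<otimes>\<^bsub>galois_group f\<^esub> \<tau>) = ?k \<sigma> \<otimes>\<^bsub>?T\<^esub> ?k \<tau>"
    unfolding j_bit_comp[OF st] e_bit_comp[OF st] d_bit_comp[OF st] h_bit_comp[OF st] ed
      of_bool_xor[of "_ \<noteq> _" "_ \<noteq> _"] quarter_turns_dihedral mult_DirProd mult_integer_mod_group
    by (auto simp: dihedral_group_def)
  show "\<sigma> = \<tau>" if "?k \<sigma> = ?k \<tau>"
    by (rule galois_bits_inj[OF st]) (use that in auto)
next
  fix z assume "z \<in> carrier ?T"
  then obtain y x t where z: "z = (y, (x, t))" "x \<in> {0..<4}" "y \<in> {0..<2}"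
    by (auto simp: dihedral_group_def carrier_integer_mod_group)
  obtain j e where je: "x = quarter_turns j e" using z(2) by (rule quarter_turnsE)
  obtain v where v: "y = of_bool v" using z(3) by (rule bitE)
  obtain \<sigma> where "\<sigma> \<in> G" "j_bit \<sigma> = j" "e_bit \<sigma> = e" "d_bit \<sigma> = (e \<noteq> v)" "h_bit \<sigma> = (j \<noteq> t)"
    using exists_all_bits[OF w, of j e "e \<noteq> v" "j \<noteq> t"] by blast
  then show "\<exists>\<sigma>\<in>G. (of_bool (e_bit \<sigma> \<noteq> d_bit \<sigma>) :: int,
      (quarter_turns (j_bit \<sigma>) (e_bit \<sigma>), j_bit \<sigma> \<noteq> h_bit \<sigma>)) = z"
    using z(1) je v by (intro bexI[of _ \<sigma>]) auto
qed

lemma galois_class: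
  "galois_group_in_class f 8
    (if w \<in> \<rat> then T8_3 else if \<exists>c. cross c \<in> \<rat> then T8_4 else if \<delta> * w \<in> \<rat> then T8_2 else T8_9)"
  using in_classI[OF galois_group_C2_C2_C2] in_classI[OF galois_group_D4]
    in_classI[OF galois_group_C4_C2] in_classI[OF galois_group_C2_D4] w_in_L_iff
  unfolding T8_2_def T8_3_def T8_4_def T8_9_def by simp blast

lemma cross_rational_iff:
  "of_rat ((b - 6 + (if c then - s else s)) / 2) \<in> rat_squares \<longleftrightarrow> cross c \<in> \<rat>"
proof -
  have "cross c / 2 \<in> \<rat> \<longleftrightarrow> cross c \<in> \<rat>"
    using Rats_mult[of "cross c / 2" 2] Rats_divide[of "cross c" 2] by auto
  then show ?thesis using rat_squares_iff[OF cross_sq] by simp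
qed

lemma \<delta>w_rational_iff: "of_rat ((a\<^sup>2 - 4 * b + 8) * (b + 2 + 2 * a)) \<in> rat_squares \<longleftrightarrow> \<delta> * w \<in> \<rat>"
  by (rule rat_squares_iff) (simp only: power_mult_distrib \<delta>_sq w_sq of_rat_mult)

end

text \<open>For arbitrary choices of the square roots the product \<open>p\<close> of all four squares to \<open>k\<^sup>2\<close>, so it
  is \<open>\<plusminus> k\<close>; if it is \<open>- k\<close>, changing the sign of \<open>M True\<close> repairs it.\<close>

lemma reciprocal_octic_exists:
  assumes irr: "Factorial_Ring.irreducible (octic a b)" and k: "k\<^sup>2 = (b + 2)\<^sup>2 - 4 * a\<^sup>2"
  shows "\<exists>u P M. reciprocal_octic a b k u P M"
proof -
  define r where "r = csqrt (of_rat (a\<^sup>2 - 4 * b + 8))"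
  define u where "u i = (- of_rat a + sg i * r) / 2" for i
  define P where "P i = csqrt (u i + 2)" for i
  define N where "N i = csqrt (u i - 2)" for i
  define p where "p = P False * P True * N False * N True"
  define M where "M i = (if i \<and> p \<noteq> of_rat k then - N i else N i)" for i
  have r: "r\<^sup>2 = of_rat a ^ 2 - 4 * of_rat b + 8"
    by (simp add: r_def of_rat_add of_rat_diff of_rat_mult of_rat_power)
  have u_sum: "u False + u True = - of_rat a" by (simp add: u_def field_simps)
  have "u False * u True = (of_rat a ^ 2 - r\<^sup>2) / 4"
    by (simp add: u_def power2_eq_square algebra_simps)
  also have "\<dots> = of_rat b - 2" unfolding r by (simp add: field_simps)
  finally have u_prod: "u False * u True = of_rat b - 2" .
  have P: "(P i)\<^sup>2 = u i + 2" and N: "(N i)\<^sup>2 = u i - 2" for i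
    by (simp_all add: P_def N_def)
  have "(u False + 2) * (u True + 2) = u False * u True + 2 * (u False + u True) + 4"
    "(u False - 2) * (u True - 2) = u False * u True - 2 * (u False + u True) + 4"
    by (simp_all add: algebra_simps)
  then have uu: "(u False + 2) * (u True + 2) = of_rat (b + 2 - 2 * a)"
    "(u False - 2) * (u True - 2) = of_rat (b + 2 + 2 * a)"
    unfolding u_sum u_prod by (simp_all add: of_rat_add of_rat_diff of_rat_mult)
  have "p\<^sup>2 = ((u False + 2) * (u True + 2)) * ((u False - 2) * (u True - 2))"
    by (simp add: p_def power_mult_distrib P N)
  also have "\<dots> = of_rat ((b + 2 - 2 * a) * (b + 2 + 2 * a))"
    unfolding uu by (simp only: of_rat_mult)
  also have "(b + 2 - 2 * a) * (b + 2 + 2 * a) = k\<^sup>2"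
    unfolding k by (simp add: power2_eq_square algebra_simps)
  finally have "p = of_rat k \<or> p = - of_rat k"
    by (simp add: of_rat_power power2_eq_iff)
  then have "P False * P True * M False * M True = of_rat k"
    by (auto simp: M_def p_def)
  then have "reciprocal_octic a b k u P M"
    using irr k u_sum u_prod P N by unfold_locales (auto simp: M_def)
  then show ?thesis by blast
qed

theorem theorem4p7:
  fixes a b :: rat and f :: "rat poly" and s :: real
  defines "f \<equiv> [:1, 0, a, 0, b, 0, a, 0, 1:]"
    and "s \<equiv> sqrt (of_rat ((b + 2)\<^sup>2 - 4 * a\<^sup>2))"
  assumes "a \<noteq> 0"
    and "Factorial_Ring.irreducible f"
    and "of_rat ((b + 2)\<^sup>2 - 4 * a\<^sup>2) \<in> rat_squares"
  shows "galois_group_in_class f 8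
    (if of_rat (b + 2 + 2 * a) \<in> rat_squares then T8_3
     else if (of_rat b - 6 + s) / 2 \<in> rat_squares \<or> (of_rat b - 6 - s) / 2 \<in> rat_squares then T8_4
     else if of_rat ((a\<^sup>2 - 4 * b + 8) * (b + 2 + 2 * a)) \<in> rat_squares then T8_2
     else T8_9)"
proof -
  obtain k :: rat where "(of_rat ((b + 2)\<^sup>2 - 4 * a\<^sup>2) :: real) = of_rat (k\<^sup>2)"
    using assms(5) by (auto simp: rat_squares_def of_rat_power)
  then have k: "k\<^sup>2 = (b + 2)\<^sup>2 - 4 * a\<^sup>2" by (simp only: of_rat_eq_iff)
  obtain u P M where "reciprocal_octic a b k u P M"
    using reciprocal_octic_exists[OF _ k] assms(4) unfolding f_def by blast
  then interpret reciprocal_octic a b k u P M .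
  have "s = \<bar>of_rat k\<bar>"
    unfolding s_def k[symmetric] by (simp add: of_rat_power)
  then have "s = of_rat k \<or> s = - of_rat k" by linarith
  \<comment> \<open>The sign of \<open>k\<close> is immaterial because the condition is symmetric under \<open>s \<mapsto> - s\<close>.\<close>
  moreover have "(of_rat b - 6 + of_rat k) / 2 = (of_rat ((b - 6 + k) / 2) :: real)"
    "(of_rat b - 6 - of_rat k) / 2 = (of_rat ((b - 6 + - k) / 2) :: real)"
    by (simp_all add: of_rat_add of_rat_diff of_rat_divide of_rat_minus)
  ultimately have cond2: "((of_rat b - 6 + s) / 2 \<in> rat_squares \<or> (of_rat b - 6 - s) / 2 \<in> rat_squares)
      \<longleftrightarrow> (\<exists>c. cross c \<in> \<rat>)"
    unfolding ex_bool_eq cross_rational_iff[symmetric] by auto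
  show ?thesis
    unfolding rat_squares_iff[OF w_sq] \<delta>w_rational_iff cond2 f_def by (rule galois_class)
qed

end
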